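(* Let $\alpha\in(0,2\pi)$, let $\mathcal{D}$ be the wedge of angle $\alpha$, let $T>0$, let $x_0=(r_0\cos\theta_0,r_0\sin\theta_0)\in\mathcal{D}$, and let $(\tau_i)_{i\ge1}$ be the random durations generated by Algorithm II (described in the context) started from $x_0$. Define $$N:=\inf\{n\in\mathbb{N}:\ \tau_1+\cdots+\tau_n>T\}.$$ Then $N<\infty$ almost surely. That is, the algorithm terminates in finite time.
   Context: $\mathcal{D}=\{(r\cos\theta,r\sin\theta): r\ge0,\ \theta\in[0,\alpha]\}$. Let $\Theta:=\max\left(\{\pi/m: m\in\mathbb{N}, m\ge1\}\cap(0,\alpha]\right)$. Algorithm II (for the simulation of the value at time $T$ of Brownian motion with unit diffusion matrix, normally reflected in $\mathcal{D}$) generates random variables recursively. Start with $y_0=x_0=(r_0\cos\theta_0,r_0\sin\theta_0)$, $\theta_0\in[0,\alpha]$, and with $T_0=0$. Given $y_n=(r_n\cos\theta_n,r_n\sin\theta_n)\in\mathcal{D}$, set $\beta_{n+1}^\pm=\theta_n\pm\Theta/2$, and let $\mathcal{V}_{n+1}$ be the wedge with apex at the origin consisting of the points of polar angle in $[\beta_{n+1}^-,\beta_{n+1}^+]$ (not necessarily contained in $\mathcal{D}$). Conditionally on the past, let $Z$ be a standard planar Brownian motion started at $y_n$ at time $0$; let $\tau_{n+1}$ be its first hitting time of $\partial\mathcal{V}_{n+1}$, let $z_{n+1}=Z_{\tau_{n+1}}$, and let $r_{n+1}$ and $\widetilde\theta_{n+1}\in\{\beta_{n+1}^-,\beta_{n+1}^+\}$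 be the radius and angle of $z_{n+1}$. Set $\theta_{n+1}=\widetilde\theta_{n+1}$ if $\widetilde\theta_{n+1}\in[0,\alpha]$, $\theta_{n+1}=-\widetilde\theta_{n+1}$ if $\widetilde\theta_{n+1}=\beta_{n+1}^-<0$, and $\theta_{n+1}=2\alpha-\widetilde\theta_{n+1}$ if $\widetilde\theta_{n+1}=\beta_{n+1}^+>\alpha$. Set $y_{n+1}=(r_{n+1}\cos\theta_{n+1},r_{n+1}\sin\theta_{n+1})\in\mathcal{D}$ and $T_{n+1}=T_n+\tau_{n+1}$. The algorithm iterates as long as $T_n+\tau_{n+1}<T$. If $T_n+\tau_{n+1}>T$, it instead draws the value at time $T-T_n$ of a Brownian motion started at $y_n$ conditioned to stay in $\mathcal{V}_{n+1}$ during $[0,T-T_n]$, folds it into $\mathcal{D}$ by the same reflections, returns the result and stops. For defining $N$, the recursion producing the $\tau_i$ is understood to be continued indefinitely.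
   Formalization: The starting point x_0 is assumed not to be the apex (r_0 > 0); for x_0 = 0 the process starts on the boundary of the first wedge, so all durations τ_i are 0, N is infinite and the claim fails. *)

theory Defs
  imports "HOL-Probability.Probability"
begin

text \<open>The plane is identified with the complex numbers, so that the point with polar
  coordinates \<open>(r, \<phi>)\<close> is \<^term>\<open>rcis r \<phi>\<close>.\<close>

text \<open>The definition of Brownian motion started at the origin, with unit diffusion matrix:
  the density below is that of the centred planar Gaussian law with covariance matrix
  \<open>(t - s) I\<close>. Values of \<open>W\<close> at negative times are irrelevant.\<close>

definition planar_brownian_motion :: "'a measure \<Rightarrow> (real \<Rightarrow> 'a \<Rightarrow> complex) \<Rightarrow> bool" where
  "planar_brownian_motion M W \<longleftrightarrow>
     (\<forall>t\<ge>0. W t \<in> borel_measurable M) \<and>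
     (\<forall>\<omega>\<in>space M. W 0 \<omega> = 0 \<and> continuous_on {0..} (\<lambda>t. W t \<omega>)) \<and>
     (\<forall>s t. 0 \<le> s \<longrightarrow> s < t \<longrightarrow>
        distributed M lborel (\<lambda>\<omega>. W t \<omega> - W s \<omega>)
          (\<lambda>z. ennreal (normal_density 0 (sqrt (t - s)) (Re z) *
                        normal_density 0 (sqrt (t - s)) (Im z)))) \<and>
     (\<forall>(t :: nat \<Rightarrow> real) n. 0 \<le> t 0 \<longrightarrow> mono t \<longrightarrow>
        prob_space.indep_vars M (\<lambda>_. borel) (\<lambda>i \<omega>. W (t (Suc i)) \<omega> - W (t i) \<omega>) {..<n})"

definition wedge :: "real \<Rightarrow> real \<Rightarrow> complex set" where
  "wedge a b = {rcis r \<phi> | r \<phi>. 0 \<le> r \<and> \<phi> \<in> {a..b}}"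

text \<open>\<open>Max\<close> is only specified on finite sets, hence \<open>GREATEST\<close>.\<close>

definition Theta :: "real \<Rightarrow> real" where
  "Theta \<alpha> = (GREATEST \<phi>. \<phi> \<in> {pi / real m | m. 1 \<le> m} \<inter> {0<..\<alpha>})"

lemma Theta_is_max:
  assumes "0 < \<alpha>"
  shows "Theta \<alpha> \<in> {pi / real m | m. 1 \<le> m} \<inter> {0<..\<alpha>}"
    and "\<And>\<phi>. \<phi> \<in> {pi / real m | m. 1 \<le> m} \<inter> {0<..\<alpha>} \<Longrightarrow> \<phi> \<le> Theta \<alpha>"
proof -
  let ?S = "{pi / real m | m. 1 \<le> m} \<inter> {0<..\<alpha>}"
  let ?P = "\<lambda>m::nat. 1 \<le> m \<and> pi / real m \<le> \<alpha>"
  define k where "k = (LEAST m. ?P m)"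
  obtain m0 :: nat where m0: "pi / \<alpha> < real m0"
    using reals_Archimedean2 by blast
  moreover have "0 < pi / \<alpha>" using assms by simp
  ultimately have "0 < real m0" by linarith
  then have "?P m0" using m0 assms by (auto simp: field_simps)
  then have k: "?P k" and k_le: "\<And>m. ?P m \<Longrightarrow> k \<le> m"
    unfolding k_def by (rule LeastI) (rule Least_le)
  have mem: "pi / real k \<in> ?S" using k by auto
  have upper: "\<phi> \<le> pi / real k" if "\<phi> \<in> ?S" for \<phi>
  proof -
    from that obtain m where m: "\<phi> = pi / real m" "?P m" by auto
    with k_le[of m] k show ?thesis by (auto intro!: divide_left_mono)
  qed
  have "Theta \<alpha> = pi / real k"
    unfolding Theta_def by (rule Greatest_equality) (use mem upper in auto)
  with mem upper show "Theta \<alpha> \<in> ?S" "\<And>\<phi>. \<phi> \<in> ?S \<Longrightarrow> \<phi> \<le> Theta \<alpha>" by auto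
qed

text \<open>Infinite if the path \<open>w\<close> never visits \<open>A\<close>.\<close>

definition hitting_time :: "(real \<Rightarrow> complex) \<Rightarrow> complex set \<Rightarrow> ereal" where
  "hitting_time w A = (INF t\<in>{t. 0 \<le> t \<and> w t \<in> A}. ereal t)"

definition exit_time :: "real \<Rightarrow> real \<Rightarrow> (real \<Rightarrow> complex) \<Rightarrow> ereal" where
  "exit_time \<alpha> \<theta> w =
     hitting_time w (frontier (wedge (\<theta> - Theta \<alpha> / 2) (\<theta> + Theta \<alpha> / 2)))"

definition exit_point :: "real \<Rightarrow> real \<Rightarrow> (real \<Rightarrow> complex) \<Rightarrow> complex" where
  "exit_point \<alpha> \<theta> w = w (real_of_ereal (exit_time \<alpha> \<theta> w))"

text \<open>A point on the boundary of the wedge other than the apex lies on exactly one of its two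
  bounding rays. At the apex, and if the boundary is never reached (both of probability zero
  for Brownian motion started inside), the value is a dummy.\<close>

definition exit_angle :: "real \<Rightarrow> real \<Rightarrow> (real \<Rightarrow> complex) \<Rightarrow> real" where
  "exit_angle \<alpha> \<theta> w =
     (let z = exit_point \<alpha> \<theta> w
      in if z = rcis (cmod z) (\<theta> - Theta \<alpha> / 2) then \<theta> - Theta \<alpha> / 2 else \<theta> + Theta \<alpha> / 2)"

definition fold_angle :: "real \<Rightarrow> real \<Rightarrow> real" where
  "fold_angle \<alpha> \<phi> = (if \<phi> < 0 then - \<phi> else if \<phi> > \<alpha> then 2 * \<alpha> - \<phi> else \<phi>)"

text \<open>Pathwise recursion of Algorithm II for given paths: \<open>\<zeta> n\<close> is the path of the
  Brownian motion used in step \<open>n + 1\<close>, and \<open>polar \<alpha> r0 \<theta>0 \<zeta> n\<close> is \<open>(r\<^sub>n, \<theta>\<^sub>n)\<close>.\<close>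

primrec polar :: "real \<Rightarrow> real \<Rightarrow> real \<Rightarrow> (nat \<Rightarrow> real \<Rightarrow> complex) \<Rightarrow> nat \<Rightarrow> real \<times> real" where
  "polar \<alpha> r0 \<theta>0 \<zeta> 0 = (r0, \<theta>0)"
| "polar \<alpha> r0 \<theta>0 \<zeta> (Suc n) =
     (let \<theta> = snd (polar \<alpha> r0 \<theta>0 \<zeta> n)
      in (cmod (exit_point \<alpha> \<theta> (\<zeta> n)), fold_angle \<alpha> (exit_angle \<alpha> \<theta> (\<zeta> n))))"

definition position :: "real \<Rightarrow> real \<Rightarrow> real \<Rightarrow> (nat \<Rightarrow> real \<Rightarrow> complex) \<Rightarrow> nat \<Rightarrow> complex" where
  "position \<alpha> r0 \<theta>0 \<zeta> n = rcis (fst (polar \<alpha> r0 \<theta>0 \<zeta> n)) (snd (polar \<alpha> r0 \<theta>0 \<zeta> n))"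

text \<open>The index is shifted by one: \<open>duration \<alpha> r0 \<theta>0 \<zeta> n\<close> is \<open>\<tau>\<close> with index \<open>n + 1\<close>.\<close>

definition duration :: "real \<Rightarrow> real \<Rightarrow> real \<Rightarrow> (nat \<Rightarrow> real \<Rightarrow> complex) \<Rightarrow> nat \<Rightarrow> ereal" where
  "duration \<alpha> r0 \<theta>0 \<zeta> n = exit_time \<alpha> (snd (polar \<alpha> r0 \<theta>0 \<zeta> n)) (\<zeta> n)"

text \<open>Conditionally on the past \<open>Z 0, \<dots>, Z (n - 1)\<close>, the process \<open>Z n\<close> is a planar Brownian
  motion started at the current position \<open>y\<^sub>n\<close>, that is: \<open>Z n - y\<^sub>n\<close> is a planar Brownian
  motion started at the origin and independent of the past.\<close>

definition drives_algorithm_II ::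
  "'a measure \<Rightarrow> real \<Rightarrow> real \<Rightarrow> real \<Rightarrow> (nat \<Rightarrow> real \<Rightarrow> 'a \<Rightarrow> complex) \<Rightarrow> bool" where
  "drives_algorithm_II M \<alpha> r0 \<theta>0 Z \<longleftrightarrow>
     (\<forall>n. let W = (\<lambda>t \<omega>. Z n t \<omega> - position \<alpha> r0 \<theta>0 (\<lambda>k t. Z k t \<omega>) n)
          in planar_brownian_motion M W \<and>
             prob_space.indep_set M
               (sets (vimage_algebra (space M)
                  (\<lambda>\<omega>. \<lambda>(k, t)\<in>{..<n} \<times> {0..}. Z k t \<omega>) (PiM ({..<n} \<times> {0..}) (\<lambda>_. borel))))
               (sets (vimage_algebra (space M)
                  (\<lambda>\<omega>. \<lambda>t\<in>{0..}. W t \<omega>) (PiM {0..} (\<lambda>_. borel)))))"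

definition num_iterations ::
  "real \<Rightarrow> real \<Rightarrow> real \<Rightarrow> (nat \<Rightarrow> real \<Rightarrow> complex) \<Rightarrow> real \<Rightarrow> enat" where
  "num_iterations \<alpha> r0 \<theta>0 \<zeta> T =
     (INF n\<in>{n. (\<Sum>i<n. duration \<alpha> r0 \<theta>0 \<zeta> i) > ereal T}. enat n)"

end

theory Submission
  imports Defs
begin

text \<open>Let \<open>T\<^sub>n = \<tau>\<^sub>1 + \<dots> + \<tau>\<^sub>n\<close> and let \<open>r\<^sub>n\<close> be the radius of \<open>y\<^sub>n\<close>. Planar Brownian motion started
  away from the origin does not approach it in bounded time: let \<open>K(x)\<close> be the integral over \<open>s > 0\<close>
  of \<open>exp(-s)\<close> times the heat kernel \<open>p\<^sub>s(x)\<close>, which is radial, finite off \<open>0\<close> and infinite at \<open>0\<close>.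
  By optional stopping \<open>exp(-T\<^sub>n) K(r\<^sub>n)\<close> is a nonnegative supermartingale, so its \<open>liminf\<close> is
  almost surely finite. Optional stopping with a multiple of \<open>1 + |x - y\<^sub>n|\<^sup>2 / 2\<close> bounds the conditional
  expectation of the next \<open>exp(-\<tau>)\<close> by some \<open>a(r\<^sub>n) \<le> 1\<close> that is close to \<open>1\<close> only for small \<open>r\<^sub>n\<close>. Since the
  expectations of \<open>exp(-T\<^sub>n)\<close> decrease by at most \<open>1\<close> in total, the series of \<open>exp(-T\<^sub>n) (1 - a(r\<^sub>n))\<close>
  converges almost surely. If \<open>T\<^sub>n\<close> stayed bounded, this would force \<open>r\<^sub>n\<close> to \<open>0\<close> and hence
  \<open>exp(-T\<^sub>n) K(r\<^sub>n)\<close> to infinity.\<close>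

subsection \<open>Planar heat semigroup and excessive functions\<close>

text \<open>The increment density of \<open>planar_brownian_motion\<close>, that is, the heat kernel
  of half the Laplacian. Here \<open>t\<close> is the variance of each coordinate, whereas
  \<open>normal_density\<close> takes the standard deviation.\<close>

definition gauss2 :: "real \<Rightarrow> complex \<Rightarrow> real" where
  "gauss2 t z = normal_density 0 (sqrt t) (Re z) * normal_density 0 (sqrt t) (Im z)"

lemma gauss2_nonneg [simp]: "0 \<le> gauss2 t z"
  by (simp add: gauss2_def)

lemma measurable_Complex [measurable]:
  assumes [measurable]: "f \<in> borel_measurable M" "g \<in> borel_measurable M"
  shows "(\<lambda>x. Complex (f x) (g x)) \<in> borel_measurable M"
  unfolding Complex_eq by measurable

lemma gauss2_eq:
  assumes "0 < t"
  shows "gauss2 t z = exp (- (cmod z)\<^sup>2 / (2 * t)) / (2 * pi * t)"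
proof -
  have "gauss2 t z = (1 / sqrt (2 * pi * t))\<^sup>2 * (exp (- (Re z)\<^sup>2 / (2 * t)) * exp (- (Im z)\<^sup>2 / (2 * t)))"
    using assms by (simp add: gauss2_def normal_density_def power2_eq_square)
  also have "exp (- (Re z)\<^sup>2 / (2 * t)) * exp (- (Im z)\<^sup>2 / (2 * t)) = exp (- (cmod z)\<^sup>2 / (2 * t))"
    by (simp add: cmod_power2 diff_divide_distrib flip: exp_add)
  finally show ?thesis
    using assms by (simp add: power_divide)
qed

lemma gauss2_measurable [measurable]:
  assumes [measurable]: "f \<in> borel_measurable M" "g \<in> borel_measurable M"
  shows "(\<lambda>x. gauss2 (f x) (g x)) \<in> borel_measurable M"
  unfolding gauss2_def normal_density_def by measurable

text \<open>Lebesgue measure is determined by its values on boxes, and \<open>Basis\<close> is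
  \<open>{1, \<i>}\<close>. Planar Gaussian integrals thereby become iterated one-dimensional
  ones.\<close>

lemma lborel_complex: "(lborel :: complex measure) = distr (lborel \<Otimes>\<^sub>M lborel) borel (\<lambda>(u, v). Complex u v)"
proof (rule lborel_eqI)
  fix l u :: complex assume lu: "\<And>b. b \<in> Basis \<Longrightarrow> l \<bullet> b \<le> u \<bullet> b"
  have le: "Re l \<le> Re u" "Im l \<le> Im u"
    using lu[of 1] lu[of \<i>] by (auto simp: Basis_complex_def)
  have box: "box l u = {z. Re l < Re z \<and> Re z < Re u \<and> Im l < Im z \<and> Im z < Im u}"
    by (auto simp: box_def Basis_complex_def)
  have "(\<lambda>(u, v). Complex u v) -` box l u \<inter> space (lborel \<Otimes>\<^sub>M lborel) = {Re l<..<Re u} \<times> {Im l<..<Im u}"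
    by (auto simp: box space_pair_measure)
  then have "emeasure (distr (lborel \<Otimes>\<^sub>M lborel) borel (\<lambda>(u, v). Complex u v)) (box l u)
      = emeasure (lborel \<Otimes>\<^sub>M lborel) ({Re l<..<Re u} \<times> {Im l<..<Im u})"
    by (subst emeasure_distr) auto
  also have "\<dots> = ennreal (Re u - Re l) * ennreal (Im u - Im l)"
    using le by (subst lborel.emeasure_pair_measure_Times) auto
  also have "\<dots> = ennreal (\<Prod>b\<in>Basis. (u - l) \<bullet> b)"
    using le by (simp add: Basis_complex_def ennreal_mult)
  finally show "emeasure (distr (lborel \<Otimes>\<^sub>M lborel) borel (\<lambda>(u, v). Complex u v)) (box l u)
      = ennreal (\<Prod>b\<in>Basis. (u - l) \<bullet> b)" .
qed simp

lemma nn_integral_lborel_complex: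
  assumes [measurable]: "f \<in> borel_measurable (borel :: complex measure)"
  shows "(\<integral>\<^sup>+z. f z \<partial>lborel) = (\<integral>\<^sup>+u. \<integral>\<^sup>+v. f (Complex u v) \<partial>lborel \<partial>lborel)"
proof -
  have "(\<integral>\<^sup>+z. f z \<partial>lborel) = (\<integral>\<^sup>+p. f (case p of (u, v) \<Rightarrow> Complex u v) \<partial>(lborel \<Otimes>\<^sub>M lborel))"
    by (subst lborel_complex, subst nn_integral_distr) auto
  also have "\<dots> = (\<integral>\<^sup>+u. \<integral>\<^sup>+v. f (Complex u v) \<partial>lborel \<partial>lborel)"
    by (subst lborel.nn_integral_fst[symmetric]) auto
  finally show ?thesis .
qed

text \<open>The density is even, so the usual convolution, evaluated at \<open>- x\<close>, covers
  the form \<open>x + y\<close>, in which an increment is added to a starting point.\<close>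

lemma conv_normal_density_zero_mean_plus:
  assumes "0 < s" "0 < t"
  shows "(\<integral>\<^sup>+y. ennreal (normal_density 0 (sqrt s) (x + y)) * ennreal (normal_density 0 (sqrt t) y) \<partial>lborel)
    = ennreal (normal_density 0 (sqrt (s + t)) x)"
proof -
  have "normal_density 0 (sqrt s) (x + y) = normal_density 0 (sqrt s) (- x - y)" for y
    by (simp add: normal_density_def power2_eq_square algebra_simps)
  then have "(\<integral>\<^sup>+y. ennreal (normal_density 0 (sqrt s) (x + y)) * ennreal (normal_density 0 (sqrt t) y) \<partial>lborel)
     = (\<integral>\<^sup>+y. ennreal (normal_density 0 (sqrt s) (- x - y) * normal_density 0 (sqrt t) y) \<partial>lborel)"
    by (simp add: ennreal_mult)
  also have "\<dots> = ennreal (normal_density 0 (sqrt (s + t)) (- x))"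
    using fun_cong[OF conv_normal_density_zero_mean[of "sqrt s" "sqrt t"], of "- x"] assms by simp
  finally show ?thesis
    by (simp add: normal_density_def)
qed

lemma gauss2_convolution:
  assumes "0 < s" "0 < t"
  shows "(\<integral>\<^sup>+z. ennreal (gauss2 s (x + z)) * ennreal (gauss2 t z) \<partial>lborel) = ennreal (gauss2 (s + t) x)"
proof -
  let ?n = "\<lambda>s x. ennreal (normal_density 0 (sqrt s) x)"
  have "(\<integral>\<^sup>+z. ennreal (gauss2 s (x + z)) * ennreal (gauss2 t z) \<partial>lborel)
      = (\<integral>\<^sup>+u. \<integral>\<^sup>+v. (?n s (Re x + u) * ?n t u) * (?n s (Im x + v) * ?n t v) \<partial>lborel \<partial>lborel)"
    by (subst nn_integral_lborel_complex) (auto simp: gauss2_def ennreal_mult ac_simps)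
  also have "\<dots> = ?n (s + t) (Re x) * ?n (s + t) (Im x)"
    by (simp add: nn_integral_cmult nn_integral_multc conv_normal_density_zero_mean_plus assms)
  finally show ?thesis
    by (simp add: gauss2_def ennreal_mult)
qed

section \<open>Mass and second moments of Gaussian densities\<close>

lemma nn_integral_normal_density:
  assumes "0 < t"
  shows "(\<integral>\<^sup>+y. ennreal (normal_density 0 (sqrt t) y) \<partial>lborel) = 1"
  using assms by (subst nn_integral_eq_integral) auto

lemma nn_integral_normal_density_square:
  assumes "0 < t"
  shows "(\<integral>\<^sup>+y. ennreal ((x + y)\<^sup>2) * ennreal (normal_density 0 (sqrt t) y) \<partial>lborel) = ennreal (x\<^sup>2 + t)"
proof -
  have t: "0 < sqrt t" using assms by simp
  \<comment> \<open>The square is expanded into second, first and zeroth moments, which contribute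
    \<open>t\<close>, 0 and \<open>x\<^sup>2\<close>.\<close>
  have "has_bochner_integral lborel
      (\<lambda>y. (normal_density 0 (sqrt t) y * (y - 0) ^ (2 * 1) + (2 * x) * (normal_density 0 (sqrt t) y * y))
         + x\<^sup>2 * (normal_density 0 (sqrt t) y * (y - 0) ^ (2 * 0)))
      ((fact (2 * 1) / ((2 / (sqrt t)\<^sup>2) ^ 1 * fact 1) + (2 * x) * 0) + x\<^sup>2 * (fact (2 * 0) / ((2 / (sqrt t)\<^sup>2) ^ 0 * fact 0)))"
    by (intro has_bochner_integral_add has_bochner_integral_mult_right normal_moment_even normal_moment_nz_1 t)
  also have "(\<lambda>y. (normal_density 0 (sqrt t) y * (y - 0) ^ (2 * 1) + (2 * x) * (normal_density 0 (sqrt t) y * y))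
         + x\<^sup>2 * (normal_density 0 (sqrt t) y * (y - 0) ^ (2 * 0)))
       = (\<lambda>y. (x + y)\<^sup>2 * normal_density 0 (sqrt t) y)"
    by (auto simp: power2_eq_square algebra_simps)
  finally have "has_bochner_integral lborel (\<lambda>y. (x + y)\<^sup>2 * normal_density 0 (sqrt t) y) (x\<^sup>2 + t)"
    using assms by (simp add: add.commute)
  then show ?thesis
    by (subst ennreal_mult[symmetric])
       (auto simp: has_bochner_integral_iff intro!: trans[OF nn_integral_eq_integral])
qed

lemma nn_integral_gauss2:
  assumes "0 < t"
  shows "(\<integral>\<^sup>+z. ennreal (gauss2 t z) \<partial>lborel) = 1"
  by (subst nn_integral_lborel_complex)
     (auto simp: gauss2_def ennreal_mult nn_integral_cmult nn_integral_normal_density assms)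

text \<open>Each of the two coordinates contributes \<open>t\<close>; this explains the factor 1/2
  in \<open>excessive_quadratic\<close>.\<close>

lemma nn_integral_gauss2_square:
  assumes "0 < t"
  shows "(\<integral>\<^sup>+z. ennreal ((cmod (x + z))\<^sup>2) * ennreal (gauss2 t z) \<partial>lborel) = ennreal ((cmod x)\<^sup>2 + 2 * t)"
proof -
  let ?n = "\<lambda>x. ennreal (normal_density 0 (sqrt t) x)"
  have "(\<integral>\<^sup>+z. ennreal ((cmod (x + z))\<^sup>2) * ennreal (gauss2 t z) \<partial>lborel)
      = (\<integral>\<^sup>+u. \<integral>\<^sup>+v. (ennreal ((Re x + u)\<^sup>2) * ?n u) * ?n v + ?n u * (ennreal ((Im x + v)\<^sup>2) * ?n v) \<partial>lborel \<partial>lborel)"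
    by (subst nn_integral_lborel_complex)
       (auto simp: gauss2_def ennreal_mult cmod_power2 algebra_simps)
  also have "\<dots> = ennreal ((Re x)\<^sup>2 + t) + ennreal ((Im x)\<^sup>2 + t)"
    by (simp add: nn_integral_add nn_integral_cmult nn_integral_multc nn_integral_normal_density
        nn_integral_normal_density_square assms)
  also have "\<dots> = ennreal ((cmod x)\<^sup>2 + 2 * t)"
    using assms by (simp add: cmod_power2 flip: ennreal_plus)
  finally show ?thesis .
qed

section \<open>The transition semigroup of planar Brownian motion and its excessive
  functions\<close>

definition heat :: "real \<Rightarrow> (complex \<Rightarrow> ennreal) \<Rightarrow> complex \<Rightarrow> ennreal" where
  "heat h f x = (\<integral>\<^sup>+z. f (x + z) * ennreal (gauss2 h z) \<partial>lborel)"

text \<open>Values in \<open>ennreal\<close> admit \<open>resolvent\<close>, which is infinite at 0.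
  This half of continuity is what Fatou's lemma needs when stopping times converge.\<close>

definition lower_semicontinuous :: "(complex \<Rightarrow> ennreal) \<Rightarrow> bool" where
  "lower_semicontinuous f \<longleftrightarrow> (\<forall>X x. X \<longlonglongrightarrow> x \<longrightarrow> f x \<le> liminf (\<lambda>n. f (X n)))"

text \<open>Excessive at rate 1 for planar Brownian motion: \<open>exp(-t) f(x + W\<^sub>t)\<close> is a supermartingale.\<close>

definition excessive :: "(complex \<Rightarrow> ennreal) \<Rightarrow> bool" where
  "excessive f \<longleftrightarrow> f \<in> borel_measurable borel \<and> lower_semicontinuous f \<and>
     (\<forall>h>0. \<forall>x. ennreal (exp (- h)) * heat h f x \<le> f x)"

text \<open>The 1-resolvent kernel of planar Brownian motion; off 0 it equals
  \<open>K\<^sub>0 (sqrt 2 * cmod x) / pi\<close> with the modified Bessel function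
  \<open>K\<^sub>0\<close>. As an integral over time it is excessive by a mere shift of the
  integration variable.\<close>

definition resolvent :: "complex \<Rightarrow> ennreal" where
  "resolvent x = (\<integral>\<^sup>+s. ennreal (exp (- s) * gauss2 s x) * indicator {0<..} s \<partial>lborel)"

lemma resolvent_measurable [measurable]: "resolvent \<in> borel_measurable borel"
  unfolding resolvent_def by measurable

lemma resolvent_norm: "resolvent x = resolvent (of_real (cmod x))"
  unfolding resolvent_def by (intro nn_integral_cong) (auto simp: gauss2_eq indicator_def)

text \<open>At 0 the integrand is \<open>exp (- s) / (2 * pi * s)\<close>, which diverges
  logarithmically: the interval from \<open>exp (- n)\<close> to 1 alone contributes at least
  \<open>n * exp (-1) / (2 * pi)\<close>.\<close>

lemma resolvent_zero: "resolvent 0 = \<infinity>"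
proof -
  have "ennreal (real n * (exp (-1) / (2 * pi))) \<le> resolvent 0" for n :: nat
  proof -
    have "(\<integral>\<^sup>+s. ennreal (1 / s) * indicator {exp (- real n) .. 1} s \<partial>lborel) = ennreal (ln 1 - ln (exp (- real n)))"
      by (rule nn_integral_FTC_Icc)
         (auto intro!: derivative_eq_intros order_less_le_trans[OF exp_gt_zero] simp: field_simps
           has_real_derivative_iff_has_vector_derivative[symmetric] intro: order_trans[OF exp_ge_zero])
    then have "ennreal (real n * (exp (-1) / (2 * pi))) =
        ennreal (exp (-1) / (2 * pi)) * (\<integral>\<^sup>+s. ennreal (1 / s) * indicator {exp (- real n) .. 1} s \<partial>lborel)"
      by (simp add: mult.commute flip: ennreal_mult)
    also have "\<dots> = (\<integral>\<^sup>+s. ennreal (exp (-1) / (2 * pi)) * (ennreal (1 / s) * indicator {exp (- real n) .. 1} s) \<partial>lborel)"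
      by (subst nn_integral_cmult) auto
    also have "\<dots> \<le> resolvent 0"
      unfolding resolvent_def
    proof (intro nn_integral_mono)
      fix s :: real
      show "ennreal (exp (-1) / (2 * pi)) * (ennreal (1 / s) * indicator {exp (- real n) .. 1} s)
         \<le> ennreal (exp (- s) * gauss2 s 0) * indicator {0<..} s"
      proof (cases "s \<in> {exp (- real n) .. 1}")
        case True
        then have s: "0 < s" "s \<le> 1" by (auto intro: order_less_le_trans[OF exp_gt_zero])
        then show ?thesis
          by (auto simp: gauss2_eq indicator_def intro!: ennreal_leI divide_right_mono simp flip: ennreal_mult)
      qed simp
    qed
    finally show ?thesis .
  qed
  note le = this
  show ?thesis
  proof (rule ccontr)
    assume "resolvent 0 \<noteq> \<infinity>"
    then obtain c where c: "resolvent 0 = ennreal c" "0 \<le> c" by (cases "resolvent 0") auto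
    obtain n :: nat where "c / (exp (-1) / (2 * pi)) < real n" using reals_Archimedean2 by blast
    then have "c < real n * (exp (-1) / (2 * pi))" by (simp add: field_simps)
    with le[of n] c show False by (simp add: ennreal_le_iff)
  qed
qed

text \<open>Off the origin the heat kernel is bounded uniformly in time:
  \<open>u \<le> exp u\<close> with \<open>u = (cmod x)\<^sup>2 / (2 * s)\<close> gives the bound
  \<open>?c\<close>, and \<open>exp (- s)\<close> is integrable.\<close>

lemma resolvent_finite:
  assumes "x \<noteq> 0"
  shows "resolvent x < \<infinity>"
proof -
  let ?c = "1 / (pi * (cmod x)\<^sup>2)"
  have "exp (- s) * gauss2 s x \<le> exp (- s) * ?c" if "0 < s" for s
  proof -
    define u where "u = (cmod x)\<^sup>2 / (2 * s)"
    have u: "0 < u" using that assms by (simp add: u_def)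
    have "u \<le> exp u" using exp_ge_add_one_self[of u] by linarith
    then have "exp (- u) \<le> 1 / u" using u by (simp add: exp_minus field_simps)
    then have "exp (- u) / (2 * pi * s) \<le> (1 / u) / (2 * pi * s)"
      using that by (intro divide_right_mono) auto
    also have "\<dots> = ?c" using that assms by (simp add: u_def field_simps)
    finally have "gauss2 s x \<le> ?c" using that by (simp add: gauss2_eq u_def)
    then show ?thesis by (intro mult_left_mono) auto
  qed
  then have "resolvent x \<le> (\<integral>\<^sup>+s. ennreal ?c * (ennreal (exp (- s)) * indicator {0..} s) \<partial>lborel)"
    unfolding resolvent_def
    by (intro nn_integral_mono)
       (auto simp: indicator_def mult.commute[of ?c] simp flip: ennreal_mult intro!: ennreal_leI)
  also have "\<dots> = ennreal ?c * (\<integral>\<^sup>+s. ennreal (exp (- s)) * indicator {0..} s \<partial>lborel)"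
    by (subst nn_integral_cmult) auto
  also have "(\<integral>\<^sup>+s. ennreal (exp (- s)) * indicator {0..} s \<partial>lborel) = ennreal (0 - (- exp (- 0)))"
  proof (rule nn_integral_FTC_atLeast)
    show "((\<lambda>s :: real. - exp (- s)) \<longlongrightarrow> 0) at_top"
      using tendsto_minus[OF filterlim_compose[OF exp_at_bot filterlim_uminus_at_bot_at_top]] by simp
  qed (auto intro!: derivative_eq_intros)
  finally show ?thesis by (auto simp: less_top[symmetric] ennreal_mult_eq_top_iff top_unique)
qed

text \<open>Fatou's lemma: for each fixed \<open>s > 0\<close> the heat kernel is continuous in
  space.\<close>

lemma lower_semicontinuous_resolvent: "lower_semicontinuous resolvent"
  unfolding lower_semicontinuous_def
proof safe
  fix X :: "nat \<Rightarrow> complex" and x assume X: "X \<longlonglongrightarrow> x"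
  have "resolvent x = (\<integral>\<^sup>+s. liminf (\<lambda>n. ennreal (exp (- s) * gauss2 s (X n)) * indicator {0<..} s) \<partial>lborel)"
    unfolding resolvent_def
  proof (intro nn_integral_cong)
    fix s :: real
    have "(\<lambda>n. ennreal (exp (- s) * gauss2 s (X n)) * indicator {0<..} s) \<longlonglongrightarrow> ennreal (exp (- s) * gauss2 s x) * indicator {0<..} s"
    proof (cases "0 < s")
      case True
      then have "(\<lambda>n. ennreal (exp (- s) * gauss2 s (X n))) \<longlonglongrightarrow> ennreal (exp (- s) * gauss2 s x)"
        unfolding gauss2_eq[OF True] by (intro tendsto_intros X) auto
      with True show ?thesis by simp
    qed simp
    then show "ennreal (exp (- s) * gauss2 s x) * indicator {0<..} s
        = liminf (\<lambda>n. ennreal (exp (- s) * gauss2 s (X n)) * indicator {0<..} s)"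
      by (metis lim_imp_Liminf sequentially_bot)
  qed
  also have "\<dots> \<le> liminf (\<lambda>n. resolvent (X n))"
    unfolding resolvent_def by (rule nn_integral_liminf) simp
  finally show "resolvent x \<le> liminf (\<lambda>n. resolvent (X n))" .
qed

text \<open>By the semigroup property, applying the discounted semigroup at time \<open>h\<close>
  replaces \<open>s\<close> by \<open>s + h\<close> in the integrand. What remains is the same
  integral over \<open>s > h\<close> only.\<close>

lemma excessive_resolvent: "excessive resolvent"
  unfolding excessive_def
proof (intro conjI allI impI resolvent_measurable lower_semicontinuous_resolvent)
  fix h :: real and x :: complex assume h: "0 < h"
  let ?e = "\<lambda>s. ennreal (exp (- s))" and ?g = "\<lambda>s x. ennreal (gauss2 s x)"
  have "heat h resolvent x = (\<integral>\<^sup>+z. \<integral>\<^sup>+s. ?e s * ?g s (x + z) * indicator {0<..} s * ?g h z \<partial>lborel \<partial>lborel)"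
    unfolding heat_def resolvent_def by (intro nn_integral_cong) (simp add: nn_integral_multc ennreal_mult)
  also have "\<dots> = (\<integral>\<^sup>+s. \<integral>\<^sup>+z. ?e s * ?g s (x + z) * indicator {0<..} s * ?g h z \<partial>lborel \<partial>lborel)"
    by (rule lborel_pair.Fubini') measurable
  also have "\<dots> = (\<integral>\<^sup>+s. ?e s * indicator {0<..} s * (\<integral>\<^sup>+z. ?g s (x + z) * ?g h z \<partial>lborel) \<partial>lborel)"
    by (subst nn_integral_cmult[symmetric]) (auto simp: ac_simps)
  also have "\<dots> = (\<integral>\<^sup>+s. ?e s * indicator {0<..} s * ?g (s + h) x \<partial>lborel)"
    by (intro nn_integral_cong) (auto simp: gauss2_convolution h indicator_def)
  finally have "?e h * heat h resolvent x = (\<integral>\<^sup>+s. ?e h * (?e s * indicator {0<..} s * ?g (s + h) x) \<partial>lborel)"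
    by (simp add: nn_integral_cmult)
  also have "\<dots> = (\<integral>\<^sup>+s. ?e (s + h) * ?g (s + h) x * indicator {h<..} (s + h) \<partial>lborel)"
    by (intro nn_integral_cong)
       (auto simp: indicator_def mult_exp_exp add.commute mult.assoc[symmetric] simp flip: ennreal_mult)
  also have "\<dots> = (\<integral>\<^sup>+s. ?e s * ?g s x * indicator {h<..} s \<partial>lborel)"
    using nn_integral_real_affine[of "\<lambda>s. ?e s * ?g s x * indicator {h<..} s" 1 h] by (simp add: add.commute)
  also have "\<dots> \<le> resolvent x"
    unfolding resolvent_def using h by (intro nn_integral_mono) (auto simp: indicator_def ennreal_mult)
  finally show "?e h * heat h resolvent x \<le> resolvent x" .
qed

text \<open>With \<open>q\<close> the quadratic term, the semigroup turns \<open>1 + q\<close> into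
  \<open>1 + h + q\<close>, which is at most \<open>(1 + h) * (1 + q)\<close> and hence at most
  \<open>exp h * (1 + q)\<close>. The summand 1 is what lets the discount absorb the growth of
  \<open>q\<close>.\<close>

lemma excessive_quadratic:
  assumes "0 \<le> a"
  shows "excessive (\<lambda>x. ennreal (a * (1 + (cmod (x - y))\<^sup>2 / 2)))"
  unfolding excessive_def
proof (intro conjI allI impI)
  show "lower_semicontinuous (\<lambda>x. ennreal (a * (1 + (cmod (x - y))\<^sup>2 / 2)))"
    unfolding lower_semicontinuous_def
  proof safe
    fix X :: "nat \<Rightarrow> complex" and x assume X: "X \<longlonglongrightarrow> x"
    have "(\<lambda>n. ennreal (a * (1 + (cmod (X n - y))\<^sup>2 / 2))) \<longlonglongrightarrow> ennreal (a * (1 + (cmod (x - y))\<^sup>2 / 2))"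
      by (intro tendsto_intros X) auto
    then show "ennreal (a * (1 + (cmod (x - y))\<^sup>2 / 2)) \<le> liminf (\<lambda>n. ennreal (a * (1 + (cmod (X n - y))\<^sup>2 / 2)))"
      by (metis lim_imp_Liminf sequentially_bot order_refl)
  qed
  fix h :: real and x :: complex assume h: "0 < h"
  have "heat h (\<lambda>x. ennreal (a * (1 + (cmod (x - y))\<^sup>2 / 2))) x =
     (\<integral>\<^sup>+z. ennreal a * ennreal (gauss2 h z) + ennreal (a / 2) * (ennreal ((cmod (x - y + z))\<^sup>2) * ennreal (gauss2 h z)) \<partial>lborel)"
    unfolding heat_def using assms
    by (intro nn_integral_cong) (auto simp: algebra_simps simp flip: ennreal_mult ennreal_plus)
  also have "\<dots> = ennreal a + ennreal (a / 2) * ennreal ((cmod (x - y))\<^sup>2 + 2 * h)"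
    by (simp add: nn_integral_add nn_integral_cmult nn_integral_gauss2 nn_integral_gauss2_square h)
  also have "\<dots> = ennreal (a * (1 + h + (cmod (x - y))\<^sup>2 / 2))"
    using assms h by (simp add: algebra_simps flip: ennreal_mult ennreal_plus)
  finally have eq: "heat h (\<lambda>x. ennreal (a * (1 + (cmod (x - y))\<^sup>2 / 2))) x = \<dots>" .
  let ?q = "(cmod (x - y))\<^sup>2 / 2"
  have "1 + h + ?q \<le> (1 + h) * (1 + ?q)"
    using h by (simp add: algebra_simps)
  also have "\<dots> \<le> exp h * (1 + ?q)"
    using exp_ge_add_one_self[of h] by (intro mult_right_mono) auto
  finally have "exp (- h) * (1 + h + ?q) \<le> 1 + ?q"
    by (simp add: exp_minus field_simps)
  then have "a * (exp (- h) * (1 + h + ?q)) \<le> a * (1 + ?q)"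
    using assms by (rule mult_left_mono)
  then show "ennreal (exp (- h)) * heat h (\<lambda>x. ennreal (a * (1 + (cmod (x - y))\<^sup>2 / 2))) x
      \<le> ennreal (a * (1 + (cmod (x - y))\<^sup>2 / 2))"
    unfolding eq using assms h by (auto simp: mult.left_commute simp flip: ennreal_mult intro!: ennreal_leI)
qed simp

subsection \<open>Hitting times along dyadic grids\<close>

text \<open>The infinite case is set apart because \<open>real_of_ereal \<infinity> = 0\<close>
  would give 1. With the value 0, paths that never hit contribute nothing, whatever dummy value
  stands for their exit point.\<close>

definition discount :: "ereal \<Rightarrow> ennreal" where
  "discount t = (if t = \<infinity> then 0 else ennreal (exp (- real_of_ereal t)))"

lemma discount_measurable [measurable]: "discount \<in> borel_measurable borel"
  unfolding discount_def by measurable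

lemma discount_PInfty [simp]: "discount \<infinity> = 0" and discount_ereal [simp]: "discount (ereal t) = ennreal (exp (- t))"
  by (simp_all add: discount_def)

lemma discount_zero [simp]: "discount 0 = 1"
  by (simp add: discount_def)

lemma discount_add: "0 \<le> s \<Longrightarrow> 0 \<le> t \<Longrightarrow> discount (s + t) = discount s * discount t"
  by (cases s; cases t) (auto simp: mult_exp_exp simp flip: ennreal_mult)

lemma discount_antimono: "0 \<le> s \<Longrightarrow> s \<le> t \<Longrightarrow> discount t \<le> discount s"
  by (cases s; cases t) auto

text \<open>Here \<open>b\<close> may be infinite, as happens for \<open>resolvent\<close> at 0. A
  finite \<open>l\<close> below \<open>b\<close> replaces it, so that the products
  \<open>a' n * l\<close> converge and can be compared with any \<open>y < a * b\<close>.\<close>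

lemma mult_liminf_le_ennreal:
  fixes a :: ennreal
  assumes a: "(\<lambda>n. a' n) \<longlonglongrightarrow> a" and b: "b \<le> liminf b'" and "a \<noteq> \<infinity>"
  shows "a * b \<le> liminf (\<lambda>n. a' n * b' n)"
proof (cases "a = 0")
  case False
  then obtain c where c: "a = ennreal c" "0 < c" using assms(3) by (cases a) (auto simp: less_le)
  show ?thesis
    unfolding le_Liminf_iff
  proof safe
    fix y assume y: "y < a * b"
    have "y * ennreal (1 / c) < b"
    proof (rule ccontr)
      assume "\<not> ?thesis"
      then have "a * b \<le> a * (y * ennreal (1 / c))" by (intro mult_left_mono) auto
      also have "\<dots> = (a * ennreal (1 / c)) * y" by (simp add: ac_simps)
      also have "\<dots> = y" using c by (simp flip: ennreal_mult)
      finally show False using y by simp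
    qed
    then obtain l where l: "y * ennreal (1 / c) < l" "l < b" using dense by blast
    have "y = a * (y * ennreal (1 / c))"
    proof -
      have "a * (y * ennreal (1 / c)) = (a * ennreal (1 / c)) * y" by (simp add: ac_simps)
      then show ?thesis using c by (simp flip: ennreal_mult)
    qed
    also have "\<dots> < a * l"
      using l c by (intro ennreal_mult_strict_left_mono) auto
    finally have "y < a * l" .
    moreover have "l < top" using l(2) by (meson less_le_trans top_greatest)
    then have "(\<lambda>n. a' n * l) \<longlonglongrightarrow> a * l"
      using a assms(3) by (intro tendsto_mult_ennreal tendsto_const) auto
    ultimately have "eventually (\<lambda>n. y < a' n * l) sequentially" by (rule order_tendstoD(1)[rotated])
    moreover have "eventually (\<lambda>n. l < b' n) sequentially"
      using b l(2) unfolding le_Liminf_iff by blast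
    ultimately show "eventually (\<lambda>n. y < a' n * b' n) sequentially"
      by eventually_elim (meson less_le_trans less_imp_le mult_left_mono zero_le)
  qed
qed simp

lemma continuous_path_tendsto:
  fixes w :: "real \<Rightarrow> 'a :: topological_space"
  assumes "continuous_on {0..} w" "u \<longlonglongrightarrow> t" "\<And>n. 0 \<le> u n"
  shows "(\<lambda>n. w (u n)) \<longlonglongrightarrow> w t"
proof -
  have "0 \<le> t" using assms(2,3) by (intro LIMSEQ_le_const) auto
  then show ?thesis
    using continuous_on_tendsto_compose[OF assms(1,2)] assms(3) by auto
qed

text \<open>For infinite \<open>t\<close> the left-hand side is 0. For finite \<open>t\<close> the
  times are eventually finite, the discounts converge, and path continuity combines with
  semicontinuity of \<open>f\<close>.\<close>

lemma discounted_value_liminf: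
  assumes w: "continuous_on {0..} w" and f: "lower_semicontinuous f"
    and s: "s \<longlonglongrightarrow> t" and s0: "\<And>n. 0 \<le> s n"
  shows "discount t * f (w (real_of_ereal t)) \<le> liminf (\<lambda>n. discount (s n) * f (w (real_of_ereal (s n))))"
proof (cases "t = \<infinity>")
  case False
  have t0: "0 \<le> t" using s s0 by (intro LIMSEQ_le_const) auto
  then obtain r where r: "t = ereal r" "0 \<le> r" using False by (cases t) auto
  have lim: "(\<lambda>n. real_of_ereal (s n)) \<longlonglongrightarrow> r"
    using s unfolding r by (rule lim_real_of_ereal)
  have "eventually (\<lambda>n. s n < \<infinity>) sequentially"
    using s unfolding r by (rule order_tendstoD) simp
  then have ev: "eventually (\<lambda>n. discount (s n) = ennreal (exp (- real_of_ereal (s n)))) sequentially"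
    by eventually_elim (auto simp: discount_def)
  have "(\<lambda>n. discount (s n)) \<longlonglongrightarrow> discount t"
    unfolding r discount_ereal tendsto_cong[OF ev] by (intro tendsto_intros lim)
  moreover have "(\<lambda>n. w (real_of_ereal (s n))) \<longlonglongrightarrow> w r"
    using w lim by (rule continuous_path_tendsto) (simp add: s0 real_of_ereal_pos)
  then have "f (w r) \<le> liminf (\<lambda>n. f (w (real_of_ereal (s n))))"
    using f unfolding lower_semicontinuous_def by blast
  ultimately show ?thesis
    using r by (intro mult_liminf_le_ennreal) auto
qed simp

section \<open>Hitting times approximated by visits at dyadic times\<close>

definition grid_time :: "nat \<Rightarrow> (real \<Rightarrow> complex) \<Rightarrow> complex set \<Rightarrow> ereal" where
  "grid_time k w B = (INF j::nat. if w (real j / 2 ^ k) \<in> B then ereal (real j / 2 ^ k) else \<infinity>)"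

text \<open>For open \<open>B\<close> and a continuous path this is the infimum of all visit times,
  because the set of visit times is relatively open.\<close>

definition dyadic_time :: "(real \<Rightarrow> complex) \<Rightarrow> complex set \<Rightarrow> ereal" where
  "dyadic_time w B = (INF k. grid_time k w B)"

text \<open>Since \<open>infdist x {} = 0\<close>, the neighbourhoods of the empty set are the whole
  plane; hence the assumptions \<open>A \<noteq> {}\<close> below.\<close>

definition nbhd :: "nat \<Rightarrow> complex set \<Rightarrow> complex set" where
  "nbhd m A = {x. infdist x A < 1 / Suc m}"

text \<open>On continuous paths this is the hitting time of the closed set \<open>A\<close>, but it depends on countably many
  values of the path only and is therefore measurable on the product space of all paths.\<close>

definition dyadic_hitting_time :: "(real \<Rightarrow> complex) \<Rightarrow> complex set \<Rightarrow> ereal" where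
  "dyadic_hitting_time w A = (SUP m. dyadic_time w (nbhd m A))"

definition dyadic_ceiling :: "real \<Rightarrow> nat \<Rightarrow> real" where
  "dyadic_ceiling t k = real (nat \<lceil>t * 2 ^ k\<rceil>) / 2 ^ k"

text \<open>A version of evaluation at \<open>t\<close> that reads the path at dyadic times only,
  and so stays measurable on a product space when \<open>t\<close> itself depends on the
  path.\<close>

definition dyadic_value :: "(real \<Rightarrow> complex) \<Rightarrow> real \<Rightarrow> complex" where
  "dyadic_value w t = lim (\<lambda>k. w (dyadic_ceiling t k))"

lemma dyadic_ceiling_nonneg [simp]: "0 \<le> dyadic_ceiling t k"
  by (simp add: dyadic_ceiling_def)

lemma dyadic_ceiling_bounds:
  assumes "0 \<le> t"
  shows "t \<le> dyadic_ceiling t k" "dyadic_ceiling t k \<le> t + (1 / 2) ^ k"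
proof -
  have *: "real (nat \<lceil>t * 2 ^ k\<rceil>) = of_int \<lceil>t * 2 ^ k\<rceil>"
    using assms by simp
  show "t \<le> dyadic_ceiling t k"
    unfolding dyadic_ceiling_def * by (simp add: field_simps)
  have "of_int \<lceil>t * 2 ^ k\<rceil> \<le> t * 2 ^ k + (1::real)" by (rule of_int_ceiling_le_add_one)
  then show "dyadic_ceiling t k \<le> t + (1 / 2) ^ k"
    unfolding dyadic_ceiling_def * by (simp add: field_simps power_divide)
qed

lemma dyadic_ceiling_tendsto:
  assumes "0 \<le> t"
  shows "dyadic_ceiling t \<longlonglongrightarrow> t"
proof (rule tendsto_sandwich[where f = "\<lambda>_. t" and h = "\<lambda>k. t + (1 / 2) ^ k"])
  have "(\<lambda>k. t + (1 / 2) ^ k) \<longlonglongrightarrow> t + 0"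
    by (intro tendsto_intros LIMSEQ_power_zero) auto
  then show "(\<lambda>k. t + (1 / 2) ^ k) \<longlonglongrightarrow> t" by simp
qed (auto intro!: always_eventually dyadic_ceiling_bounds assms)

lemma dyadic_value_eq:
  assumes "continuous_on {0..} w" "0 \<le> t"
  shows "dyadic_value w t = w t"
  unfolding dyadic_value_def
  by (intro limI continuous_path_tendsto[OF assms(1)] dyadic_ceiling_tendsto assms) simp

lemma grid_time_nonneg [simp]: "0 \<le> grid_time k w B"
  unfolding grid_time_def by (intro INF_greatest) auto

lemma dyadic_time_nonneg [simp]: "0 \<le> dyadic_time w B"
  unfolding dyadic_time_def by (intro INF_greatest) auto

lemma dyadic_hitting_time_nonneg [simp]: "0 \<le> dyadic_hitting_time w A"
  unfolding dyadic_hitting_time_def by (intro SUP_upper2[of 0]) auto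

lemma decseq_grid_time: "decseq (\<lambda>k. grid_time k w B)"
proof (rule decseq_SucI)
  fix k
  have *: "real (2 * j) / 2 ^ Suc k = real j / 2 ^ k" for j by simp
  show "grid_time (Suc k) w B \<le> grid_time k w B"
    unfolding grid_time_def
  proof (rule INF_mono)
    fix j :: nat
    show "\<exists>i\<in>UNIV. (if w (real i / 2 ^ Suc k) \<in> B then ereal (real i / 2 ^ Suc k) else \<infinity>)
        \<le> (if w (real j / 2 ^ k) \<in> B then ereal (real j / 2 ^ k) else \<infinity>)"
      by (rule bexI[of _ "2 * j"]) (unfold *, auto)
  qed
qed

lemma grid_time_tendsto: "(\<lambda>k. grid_time k w B) \<longlonglongrightarrow> dyadic_time w B"
  unfolding dyadic_time_def by (rule LIMSEQ_INF[OF decseq_grid_time])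

lemma dyadic_time_mono: "B \<subseteq> C \<Longrightarrow> dyadic_time w C \<le> dyadic_time w B"
  unfolding dyadic_time_def grid_time_def
  by (rule INF_mono, rule bexI, rule INF_mono, rule bexI) auto

lemma nbhd_mono: "m \<le> n \<Longrightarrow> nbhd n A \<subseteq> nbhd m A"
  unfolding nbhd_def by (auto elim!: less_le_trans intro!: divide_left_mono)

lemma dyadic_time_nbhd_tendsto: "(\<lambda>m. dyadic_time w (nbhd m A)) \<longlonglongrightarrow> dyadic_hitting_time w A"
  unfolding dyadic_hitting_time_def
  by (rule LIMSEQ_SUP) (auto simp: incseq_def intro!: dyadic_time_mono nbhd_mono)

lemma dyadic_time_le:
  assumes "0 \<le> d" "w d \<in> B" "d = real j / 2 ^ k"
  shows "dyadic_time w B \<le> ereal d"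
  unfolding dyadic_time_def grid_time_def
  by (rule INF_lower2[of k], simp, rule INF_lower2[of j]) (use assms in auto)

lemma dyadic_time_lessD:
  assumes "dyadic_time w B < c"
  obtains d where "0 \<le> d" "w d \<in> B" "ereal d < c" "dyadic_time w B \<le> ereal d"
proof -
  from assms obtain k j where "(if w (real j / 2 ^ k) \<in> B then ereal (real j / 2 ^ k) else \<infinity>) < c"
    unfolding dyadic_time_def grid_time_def INF_less_iff by blast
  then have "w (real j / 2 ^ k) \<in> B" "ereal (real j / 2 ^ k) < c" by (auto split: if_splits)
  then show thesis by (intro that[of "real j / 2 ^ k"] dyadic_time_le) auto
qed

lemma hitting_time_nonneg [simp]: "0 \<le> hitting_time w A"
  unfolding hitting_time_def by (intro INF_greatest) auto

text \<open>The dyadic times approaching \<open>t\<close> from above eventually lie in the open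
  neighbourhood at every level \<open>m\<close>, by continuity of the path.\<close>

lemma dyadic_hitting_time_le:
  assumes w: "continuous_on {0..} w" and t: "0 \<le> t" "w t \<in> A"
  shows "dyadic_hitting_time w A \<le> ereal t"
  unfolding dyadic_hitting_time_def
proof (rule SUP_least)
  fix m
  have lim: "(\<lambda>k. w (dyadic_ceiling t k)) \<longlonglongrightarrow> w t"
    using w dyadic_ceiling_tendsto[OF t(1)] by (rule continuous_path_tendsto) simp
  have "(\<lambda>k. infdist (w (dyadic_ceiling t k)) A) \<longlonglongrightarrow> infdist (w t) A"
    using lim by (rule tendsto_infdist)
  then have "eventually (\<lambda>k. infdist (w (dyadic_ceiling t k)) A < 1 / Suc m) sequentially"
    by (rule order_tendstoD) (use t in auto)
  then have "eventually (\<lambda>k. dyadic_time w (nbhd m A) \<le> ereal (dyadic_ceiling t k)) sequentially"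
    by eventually_elim (rule dyadic_time_le, auto simp: nbhd_def dyadic_ceiling_def)
  moreover have "(\<lambda>k. ereal (dyadic_ceiling t k)) \<longlonglongrightarrow> ereal t"
    using dyadic_ceiling_tendsto[OF t(1)] by simp
  ultimately show "dyadic_time w (nbhd m A) \<le> ereal t"
    by (intro tendsto_lowerbound[where F = sequentially]) auto
qed

text \<open>Choose a visit \<open>d m\<close> to the neighbourhood of level \<open>m\<close> shortly
  after \<open>dyadic_time\<close>. It is squeezed between that time and
  \<open>s + 1 / Suc m\<close>, so \<open>d m\<close> tends to \<open>s\<close>, and continuity
  makes the distance of \<open>w s\<close> from \<open>A\<close> vanish.\<close>

lemma dyadic_hitting_time_in:
  assumes w: "continuous_on {0..} w" and A: "closed A" "A \<noteq> {}"
    and s: "dyadic_hitting_time w A = ereal s"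
  shows "w s \<in> A"
proof -
  have "\<exists>d. 0 \<le> d \<and> w d \<in> nbhd m A \<and> d < s + 1 / Suc m \<and> dyadic_time w (nbhd m A) \<le> ereal d" for m
  proof -
    have "dyadic_time w (nbhd m A) \<le> ereal s"
      unfolding s[symmetric] dyadic_hitting_time_def by (rule SUP_upper) simp
    also have "ereal s < ereal (s + 1 / Suc m)" by simp
    finally show ?thesis by (rule dyadic_time_lessD) auto
  qed
  then obtain d where d: "\<And>m. 0 \<le> d m" "\<And>m. w (d m) \<in> nbhd m A" "\<And>m. d m < s + 1 / Suc m"
    "\<And>m. dyadic_time w (nbhd m A) \<le> ereal (d m)" by metis
  have "(\<lambda>m. ereal (d m)) \<longlonglongrightarrow> ereal s"
  proof (rule tendsto_sandwich[where f = "\<lambda>m. dyadic_time w (nbhd m A)" and h = "\<lambda>m. ereal (s + 1 / Suc m)"])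
    show "(\<lambda>m. dyadic_time w (nbhd m A)) \<longlonglongrightarrow> ereal s"
      using dyadic_time_nbhd_tendsto[of w A] s by simp
    have "(\<lambda>m. s + inverse (real (Suc m))) \<longlonglongrightarrow> s + 0"
      by (intro tendsto_intros LIMSEQ_inverse_real_of_nat)
    then show "(\<lambda>m. ereal (s + 1 / real (Suc m))) \<longlonglongrightarrow> ereal s"
      by (simp add: inverse_eq_divide)
  qed (use d(4) less_imp_le[OF d(3)] in \<open>auto simp del: of_nat_Suc intro!: always_eventually\<close>)
  then have "d \<longlonglongrightarrow> s" by simp
  then have "(\<lambda>m. w (d m)) \<longlonglongrightarrow> w s" by (rule continuous_path_tendsto[OF w _ d(1)])
  then have "(\<lambda>m. infdist (w (d m)) A) \<longlonglongrightarrow> infdist (w s) A" by (rule tendsto_infdist)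
  moreover have "(\<lambda>m. infdist (w (d m)) A) \<longlonglongrightarrow> 0"
  proof (rule tendsto_sandwich[where f = "\<lambda>_. 0" and h = "\<lambda>m. inverse (real (Suc m))"])
    show "(\<lambda>m. inverse (real (Suc m))) \<longlonglongrightarrow> 0" by (rule LIMSEQ_inverse_real_of_nat)
    show "\<forall>\<^sub>F m in sequentially. infdist (w (d m)) A \<le> inverse (real (Suc m))"
      using d(2) by (intro always_eventually) (simp add: nbhd_def inverse_eq_divide less_imp_le)
  qed (auto simp: infdist_nonneg)
  ultimately have "infdist (w s) A = 0" by (rule LIMSEQ_unique)
  then show ?thesis using in_closed_iff_infdist_zero[OF A] by simp
qed

lemma hitting_time_eq_dyadic:
  assumes w: "continuous_on {0..} w" and A: "closed A" "A \<noteq> {}"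
  shows "hitting_time w A = dyadic_hitting_time w A"
proof (rule antisym)
  show "dyadic_hitting_time w A \<le> hitting_time w A"
    unfolding hitting_time_def by (intro INF_greatest dyadic_hitting_time_le w) auto
  show "hitting_time w A \<le> dyadic_hitting_time w A"
  proof (cases "dyadic_hitting_time w A")
    case (real s)
    with dyadic_hitting_time_nonneg[of w A] have "0 \<le> s" by simp
    with dyadic_hitting_time_in[OF assms real] show ?thesis
      unfolding real hitting_time_def by (intro INF_lower) auto
  qed (use dyadic_hitting_time_nonneg[of w A] in auto)
qed

lemma hitting_time_in:
  assumes "continuous_on {0..} w" "closed A" "A \<noteq> {}" "hitting_time w A \<noteq> \<infinity>"
  shows "w (real_of_ereal (hitting_time w A)) \<in> A"
  using assms dyadic_hitting_time_in[OF assms(1-3)] hitting_time_nonneg[of w A]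
  by (cases "hitting_time w A") (auto simp: hitting_time_eq_dyadic)

section \<open>Measurability of hitting times and of path values at random times\<close>

lemma grid_time_measurable [measurable]:
  assumes [measurable]: "\<And>t. 0 \<le> t \<Longrightarrow> w t \<in> borel_measurable M" "B \<in> sets borel"
  shows "(\<lambda>\<omega>. grid_time k (\<lambda>t. w t \<omega>) B) \<in> borel_measurable M"
proof -
  have [measurable]: "w (real j / 2 ^ k) \<in> borel_measurable M" for j :: nat by (rule assms) simp
  show ?thesis unfolding grid_time_def by measurable
qed

lemma nbhd_measurable [measurable]: "nbhd m A \<in> sets borel"
  unfolding nbhd_def by (intro borel_open open_Collect_less continuous_intros)

lemma dyadic_time_measurable [measurable]:
  assumes "\<And>t. 0 \<le> t \<Longrightarrow> w t \<in> borel_measurable M" "B \<in> sets borel"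
  shows "(\<lambda>\<omega>. dyadic_time (\<lambda>t. w t \<omega>) B) \<in> borel_measurable M"
  unfolding dyadic_time_def using grid_time_measurable[OF assms] by (intro borel_measurable_INF) auto

lemma dyadic_hitting_time_measurable [measurable]:
  assumes "\<And>t. 0 \<le> t \<Longrightarrow> w t \<in> borel_measurable M"
  shows "(\<lambda>\<omega>. dyadic_hitting_time (\<lambda>t. w t \<omega>) A) \<in> borel_measurable M"
  unfolding dyadic_hitting_time_def
  using dyadic_time_measurable[OF assms nbhd_measurable] by (intro borel_measurable_SUP) auto

lemma dyadic_value_measurable:
  fixes w :: "real \<Rightarrow> 'a \<Rightarrow> complex"
  assumes w: "\<And>t. 0 \<le> t \<Longrightarrow> w t \<in> borel_measurable M"
    and [measurable]: "\<tau> \<in> borel_measurable M"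
  shows "(\<lambda>\<omega>. dyadic_value (\<lambda>t. w t \<omega>) (\<tau> \<omega>)) \<in> borel_measurable M"
proof -
  \<comment> \<open>The rounded time has countably many values, so measurability at each fixed time
    suffices.\<close>
  have "(\<lambda>\<omega>. w (real (nat \<lceil>\<tau> \<omega> * 2 ^ k\<rceil>) / 2 ^ k) \<omega>) \<in> borel_measurable M" for k
    by (rule measurable_compose_countable[where f = "\<lambda>j. w (real j / 2 ^ k)"]) (auto intro: w)
  then show ?thesis
    unfolding dyadic_value_def dyadic_ceiling_def by (rule borel_measurable_lim_metric)
qed

lemma path_value_measurable:
  fixes w :: "real \<Rightarrow> 'a \<Rightarrow> complex"
  assumes w: "\<And>t. 0 \<le> t \<Longrightarrow> w t \<in> borel_measurable M"
    and c: "\<And>\<omega>. \<omega> \<in> space M \<Longrightarrow> continuous_on {0..} (\<lambda>t. w t \<omega>)"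
    and [measurable]: "\<tau> \<in> borel_measurable M" and t: "\<And>\<omega>. \<omega> \<in> space M \<Longrightarrow> 0 \<le> \<tau> \<omega>"
  shows "(\<lambda>\<omega>. w (\<tau> \<omega>) \<omega>) \<in> borel_measurable M"
proof -
  have "(\<lambda>\<omega>. dyadic_value (\<lambda>t. w t \<omega>) (\<tau> \<omega>)) \<in> borel_measurable M"
    using w by (rule dyadic_value_measurable) measurable
  then show ?thesis
    by (subst measurable_cong[where g = "\<lambda>\<omega>. dyadic_value (\<lambda>t. w t \<omega>) (\<tau> \<omega>)"])
       (auto simp: dyadic_value_eq c t)
qed

subsection \<open>Optional stopping for planar Brownian motion\<close>

text \<open>Independence enters as a product law; then \<open>Y\<close> may be averaged over an
  independent sample \<omega>' while \<open>X\<close> is frozen at \<omega>. This stands in for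
  conditional expectations throughout.\<close>

lemma (in prob_space) nn_integral_product_law:
  assumes [measurable]: "X \<in> measurable M S" "Y \<in> measurable M T" "f \<in> borel_measurable (S \<Otimes>\<^sub>M T)"
    and eq: "distr M S X \<Otimes>\<^sub>M distr M T Y = distr M (S \<Otimes>\<^sub>M T) (\<lambda>\<omega>. (X \<omega>, Y \<omega>))"
  shows "(\<integral>\<^sup>+\<omega>. f (X \<omega>, Y \<omega>) \<partial>M) = (\<integral>\<^sup>+\<omega>. \<integral>\<^sup>+\<omega>'. f (X \<omega>, Y \<omega>') \<partial>M \<partial>M)"
proof -
  interpret Y: prob_space "distr M T Y" by (rule prob_space_distr) measurable
  have "(\<integral>\<^sup>+\<omega>. f (X \<omega>, Y \<omega>) \<partial>M) = (\<integral>\<^sup>+p. f p \<partial>(distr M S X \<Otimes>\<^sub>M distr M T Y))"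
    unfolding eq by (subst nn_integral_distr) auto
  also have "\<dots> = (\<integral>\<^sup>+x. \<integral>\<^sup>+y. f (x, y) \<partial>distr M T Y \<partial>distr M S X)"
    by (subst Y.nn_integral_fst[symmetric]) auto
  also have "\<dots> = (\<integral>\<^sup>+\<omega>. \<integral>\<^sup>+y. f (X \<omega>, y) \<partial>distr M T Y \<partial>M)"
    by (subst nn_integral_distr) auto
  also have "\<dots> = (\<integral>\<^sup>+\<omega>. \<integral>\<^sup>+\<omega>'. f (X \<omega>, Y \<omega>') \<partial>M \<partial>M)"
  proof (rule nn_integral_cong)
    fix \<omega> assume "\<omega> \<in> space M"
    then have [measurable]: "X \<omega> \<in> space S" by (rule measurable_space[rotated]) measurable
    show "(\<integral>\<^sup>+y. f (X \<omega>, y) \<partial>distr M T Y) = (\<integral>\<^sup>+\<omega>'. f (X \<omega>, Y \<omega>') \<partial>M)"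
      by (rule nn_integral_distr) measurable
  qed
  finally show ?thesis .
qed

text \<open>The discounted process \<open>exp(-h j) f(x\<^sub>j)\<close> stopped at the first \<open>j\<close> with \<open>x\<^sub>j \<in> B\<close>.\<close>

primrec stopped :: "real \<Rightarrow> (complex \<Rightarrow> ennreal) \<Rightarrow> complex set \<Rightarrow> (nat \<Rightarrow> complex) \<Rightarrow> nat \<Rightarrow> ennreal" where
  "stopped h f B x 0 = f (x 0)"
| "stopped h f B x (Suc J) =
    (if \<exists>j\<le>J. x j \<in> B then stopped h f B x J else ennreal (exp (- (h * real (Suc J)))) * f (x (Suc J)))"

lemma stopped_not_hit:
  "\<forall>j<J. x j \<notin> B \<Longrightarrow> stopped h f B x J = ennreal (exp (- (h * real J))) * f (x J)"
  by (cases J) (auto simp del: of_nat_Suc)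

lemma stopped_hit:
  assumes "\<forall>i<j. x i \<notin> B" "x j \<in> B" "j \<le> J"
  shows "stopped h f B x J = ennreal (exp (- (h * real j))) * f (x j)"
  using assms(3)
proof (induction J rule: dec_induct)
  case base
  then show ?case using assms(1) by (rule stopped_not_hit)
next
  case (step J)
  then show ?case using assms(2) by auto
qed

lemma stopped_measurable [measurable]:
  assumes [measurable]: "\<And>j. x j \<in> borel_measurable M" "f \<in> borel_measurable borel" "B \<in> sets borel"
  shows "(\<lambda>\<omega>. stopped h f B (\<lambda>j. x j \<omega>) J) \<in> borel_measurable M"
  by (induction J) (auto simp del: of_nat_Suc)

lemma planar_brownian_motionD:
  assumes "planar_brownian_motion M W"
  shows "0 \<le> t \<Longrightarrow> W t \<in> borel_measurable M"
    and "\<omega> \<in> space M \<Longrightarrow> W 0 \<omega> = 0"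
    and "\<omega> \<in> space M \<Longrightarrow> continuous_on {0..} (\<lambda>t. W t \<omega>)"
    and "0 \<le> s \<Longrightarrow> s < t \<Longrightarrow> distributed M lborel (\<lambda>\<omega>. W t \<omega> - W s \<omega>) (\<lambda>z. ennreal (gauss2 (t - s) z))"
    and "0 \<le> u 0 \<Longrightarrow> mono u \<Longrightarrow>
      prob_space.indep_vars M (\<lambda>_. borel) (\<lambda>i \<omega>. W (u (Suc i)) \<omega> - W (u i) \<omega>) {..<n :: nat}"
  using assms unfolding planar_brownian_motion_def gauss2_def by auto

text \<open>Induction on \<open>J\<close>. Whether \<open>B\<close> has been hit by index
  \<open>J\<close> depends on the first \<open>J\<close> increments only. If not, the next increment
  is independent Gaussian and excessiveness of \<open>f\<close> applies; if so, the stopped value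
  does not change.\<close>

lemma (in prob_space) nn_integral_stopped_le:
  assumes BM: "planar_brownian_motion M W" and f: "excessive f" and [measurable]: "B \<in> sets borel" and h: "0 < h"
  shows "(\<integral>\<^sup>+\<omega>. stopped h f B (\<lambda>j. y + W (real j * h) \<omega>) J \<partial>M) \<le> f y"
proof (induction J)
  case 0
  have "(\<integral>\<^sup>+\<omega>. f (y + W 0 \<omega>) \<partial>M) = (\<integral>\<^sup>+\<omega>. f y \<partial>M)"
    by (intro nn_integral_cong) (simp add: planar_brownian_motionD(2)[OF BM])
  then show ?case by (simp add: emeasure_space_1)
next
  case (Suc J)
  have [measurable]: "f \<in> borel_measurable borel" using f by (simp add: excessive_def)
  have [measurable]: "W (real j * h) \<in> borel_measurable M" for j
    by (rule planar_brownian_motionD(1)[OF BM]) (use h in simp)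
  define \<xi> where "\<xi> i \<omega> = W (real (Suc i) * h) \<omega> - W (real i * h) \<omega>" for i \<omega>
  have indep: "indep_vars (\<lambda>_. borel) \<xi> {..<Suc J}"
    unfolding \<xi>_def using h
    by (intro planar_brownian_motionD(5)[OF BM, where u = "\<lambda>j. real j * h"]) (auto simp: mono_def)
  define X where "X j \<omega> = y + W (real j * h) \<omega>" for j \<omega>
  have [measurable]: "X j \<in> borel_measurable M" for j unfolding X_def by measurable
  define V where "V \<omega> = (\<lambda>i\<in>{..<J}. \<xi> i \<omega>)" for \<omega>
  define U where "U \<omega> = (\<lambda>i\<in>{J}. \<xi> i \<omega>)" for \<omega>
  have VU: "indep_var (PiM {..<J} (\<lambda>_. borel)) V (PiM {J} (\<lambda>_. borel)) U"
    unfolding V_def U_def by (rule indep_var_restrict[OF indep]) auto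
  \<comment> \<open>\<open>x\<close> rebuilds the walk from its increments, so that the past up to
    index \<open>J\<close> is a function of \<open>V\<close> and the next step is
    \<open>U\<close>.\<close>
  define x where "x j v = y + (\<Sum>i<j. v i)" for j and v :: "nat \<Rightarrow> complex"
  have xV: "x j (V \<omega>) = X j \<omega>" if "\<omega> \<in> space M" "j \<le> J" for j \<omega>
  proof -
    have "(\<Sum>i<j. V \<omega> i) = (\<Sum>i<j. \<xi> i \<omega>)"
      unfolding V_def using that(2) by (intro sum.cong) auto
    also have "\<dots> = W (real j * h) \<omega> - W (real 0 * h) \<omega>"
      unfolding \<xi>_def by (rule sum_lessThan_telescope)
    finally show ?thesis
      by (simp add: x_def X_def planar_brownian_motionD(2)[OF BM that(1)])
  qed
  have x_meas: "x j \<in> borel_measurable (PiM {..<J} (\<lambda>_. borel))" if "j \<le> J" for j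
    unfolding x_def using that by (intro borel_measurable_add borel_measurable_const borel_measurable_sum measurable_component_singleton) auto
  let ?e = "\<lambda>J. ennreal (exp (- (h * real J)))"
  \<comment> \<open>\<open>F\<close> is the new discounted value, cut off to 0 where
    \<open>B\<close> has already been hit.\<close>
  define F where "F p = (if \<exists>j\<in>{..J}. x j (fst p) \<in> B then 0 else ?e (Suc J) * f (x J (fst p) + snd p J))" for p
  have [measurable]: "F \<in> borel_measurable (PiM {..<J} (\<lambda>_. borel) \<Otimes>\<^sub>M PiM {J} (\<lambda>_. borel))"
  proof -
    have [measurable]: "(\<lambda>p. x j (fst p)) \<in> borel_measurable (PiM {..<J} (\<lambda>_. borel) \<Otimes>\<^sub>M PiM {J} (\<lambda>_. borel))"
      if "j \<in> {..J}" for j by (rule measurable_compose[OF measurable_fst x_meas]) (use that in simp)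
    have [measurable]: "(\<lambda>p. x J (fst p)) \<in> borel_measurable (PiM {..<J} (\<lambda>_. borel) \<Otimes>\<^sub>M PiM {J} (\<lambda>_. borel))"
      by (rule measurable_compose[OF measurable_fst x_meas]) simp
    show ?thesis unfolding F_def
      by measurable
  qed
  let ?hit = "\<lambda>\<omega>. \<exists>j\<le>J. X j \<omega> \<in> B"
  have "?e (Suc J) * f (X (Suc J) \<omega>) = ?e (Suc J) * f (X J \<omega> + \<xi> J \<omega>)" for \<omega>
    by (simp add: X_def \<xi>_def)
  then have "(\<integral>\<^sup>+\<omega>. (if ?hit \<omega> then 0 else ?e (Suc J) * f (X (Suc J) \<omega>)) \<partial>M) = (\<integral>\<^sup>+\<omega>. F (V \<omega>, U \<omega>) \<partial>M)"
    by (intro nn_integral_cong) (auto simp: F_def U_def xV simp del: of_nat_Suc)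
  also have "\<dots> = (\<integral>\<^sup>+\<omega>. \<integral>\<^sup>+\<omega>'. F (V \<omega>, U \<omega>') \<partial>M \<partial>M)"
    using VU by (intro nn_integral_product_law) (auto simp: indep_var_distribution_eq)
  also have "\<dots> \<le> (\<integral>\<^sup>+\<omega>. (if ?hit \<omega> then 0 else stopped h f B (\<lambda>j. X j \<omega>) J) \<partial>M)"
  proof (rule nn_integral_mono)
    fix \<omega> assume \<omega>: "\<omega> \<in> space M"
    show "(\<integral>\<^sup>+\<omega>'. F (V \<omega>, U \<omega>') \<partial>M) \<le> (if ?hit \<omega> then 0 else stopped h f B (\<lambda>j. X j \<omega>) J)"
    proof (cases "?hit \<omega>")
      case False
      have d: "distributed M lborel (\<xi> J) (\<lambda>z. ennreal (gauss2 h z))"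
        using planar_brownian_motionD(4)[OF BM, of "real J * h" "real (Suc J) * h"] h
        unfolding \<xi>_def by (simp add: algebra_simps)
      have [measurable]: "\<xi> J \<in> borel_measurable M" unfolding \<xi>_def by measurable
      have "(\<integral>\<^sup>+\<omega>'. F (V \<omega>, U \<omega>') \<partial>M) = (\<integral>\<^sup>+\<omega>'. ?e (Suc J) * f (X J \<omega> + \<xi> J \<omega>') \<partial>M)"
        using False \<omega> by (intro nn_integral_cong) (auto simp: F_def U_def xV simp del: of_nat_Suc)
      also have "\<dots> = ?e (Suc J) * (\<integral>\<^sup>+\<omega>'. f (X J \<omega> + \<xi> J \<omega>') \<partial>M)"
        by (rule nn_integral_cmult) measurable
      also have "(\<integral>\<^sup>+\<omega>'. f (X J \<omega> + \<xi> J \<omega>') \<partial>M) = heat h f (X J \<omega>)"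
        unfolding heat_def
        by (subst distributed_nn_integral[OF d, symmetric]) (auto simp: mult.commute)
      also have "?e (Suc J) * heat h f (X J \<omega>) = ?e J * (ennreal (exp (- h)) * heat h f (X J \<omega>))"
        by (simp add: mult.assoc[symmetric] ennreal_mult[symmetric] mult_exp_exp algebra_simps)
      also have "\<dots> \<le> ?e J * f (X J \<omega>)"
        using f h by (intro mult_left_mono) (auto simp: excessive_def)
      also have "\<dots> = stopped h f B (\<lambda>j. X j \<omega>) J"
        using False by (intro stopped_not_hit[symmetric]) auto
      finally show ?thesis by (subst if_not_P[OF False])
    next
      case True
      then have "F (V \<omega>, U \<omega>') = 0" for \<omega>' using \<omega> by (auto simp: F_def xV)
      then show ?thesis by simp
    qed
  qed
  finally have le: "(\<integral>\<^sup>+\<omega>. (if ?hit \<omega> then 0 else ?e (Suc J) * f (X (Suc J) \<omega>)) \<partial>M)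
    \<le> (\<integral>\<^sup>+\<omega>. (if ?hit \<omega> then 0 else stopped h f B (\<lambda>j. X j \<omega>) J) \<partial>M)" .
  \<comment> \<open>The hit part is added to both sides of \<open>le\<close>; this avoids
    subtracting integrals that may be infinite.\<close>
  have "(\<integral>\<^sup>+\<omega>. stopped h f B (\<lambda>j. X j \<omega>) (Suc J) \<partial>M)
     = (\<integral>\<^sup>+\<omega>. (if ?hit \<omega> then stopped h f B (\<lambda>j. X j \<omega>) J else 0)
           + (if ?hit \<omega> then 0 else ?e (Suc J) * f (X (Suc J) \<omega>)) \<partial>M)"
    by (intro nn_integral_cong) (auto simp del: of_nat_Suc)
  also have "\<dots> = (\<integral>\<^sup>+\<omega>. (if ?hit \<omega> then stopped h f B (\<lambda>j. X j \<omega>) J else 0) \<partial>M)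
           + (\<integral>\<^sup>+\<omega>. (if ?hit \<omega> then 0 else ?e (Suc J) * f (X (Suc J) \<omega>)) \<partial>M)"
    by (rule nn_integral_add) measurable
  also have "\<dots> \<le> (\<integral>\<^sup>+\<omega>. (if ?hit \<omega> then stopped h f B (\<lambda>j. X j \<omega>) J else 0) \<partial>M)
           + (\<integral>\<^sup>+\<omega>. (if ?hit \<omega> then 0 else stopped h f B (\<lambda>j. X j \<omega>) J) \<partial>M)"
    by (rule add_left_mono[OF le])
  also have "\<dots> = (\<integral>\<^sup>+\<omega>. (if ?hit \<omega> then stopped h f B (\<lambda>j. X j \<omega>) J else 0)
           + (if ?hit \<omega> then 0 else stopped h f B (\<lambda>j. X j \<omega>) J) \<partial>M)"
    by (rule nn_integral_add[symmetric]) measurable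
  also have "\<dots> = (\<integral>\<^sup>+\<omega>. stopped h f B (\<lambda>j. X j \<omega>) J \<partial>M)"
    by (intro nn_integral_cong) auto
  also have "\<dots> \<le> f y" unfolding X_def by (rule Suc)
  finally show ?case unfolding X_def .
qed

text \<open>If the grid meets \<open>B\<close>, the stopped sequence is constant from the first
  visit on, with the left-hand side as its value; otherwise the left-hand side is 0.\<close>

lemma grid_time_stopped:
  "discount (grid_time k w B) * f (w (real_of_ereal (grid_time k w B)))
    \<le> liminf (stopped (1 / 2 ^ k) f B (\<lambda>j. w (real j * (1 / 2 ^ k))))"
proof (cases "\<exists>j. w (real j / 2 ^ k) \<in> B")
  case True
  define j where "j = (LEAST j. w (real j / 2 ^ k) \<in> B)"
  have j: "w (real j / 2 ^ k) \<in> B" "\<forall>i<j. w (real i / 2 ^ k) \<notin> B"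
    using True unfolding j_def by (auto intro: LeastI_ex dest: not_less_Least)
  have "grid_time k w B = ereal (real j / 2 ^ k)"
    unfolding grid_time_def
  proof (rule antisym)
    show "(INF j::nat. if w (real j / 2 ^ k) \<in> B then ereal (real j / 2 ^ k) else \<infinity>) \<le> ereal (real j / 2 ^ k)"
      by (rule INF_lower2[of j]) (use j in auto)
    show "ereal (real j / 2 ^ k) \<le> (INF j::nat. if w (real j / 2 ^ k) \<in> B then ereal (real j / 2 ^ k) else \<infinity>)"
    proof (intro INF_greatest)
      fix i
      show "ereal (real j / 2 ^ k) \<le> (if w (real i / 2 ^ k) \<in> B then ereal (real i / 2 ^ k) else \<infinity>)"
        using j(2) by (cases "i < j") (auto simp: divide_right_mono)
    qed
  qed
  moreover have "eventually (\<lambda>J. stopped (1 / 2 ^ k) f B (\<lambda>j. w (real j * (1 / 2 ^ k))) J =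
      ennreal (exp (- (real j / 2 ^ k))) * f (w (real j / 2 ^ k))) sequentially"
    using eventually_ge_at_top[of j]
  proof eventually_elim
    case (elim J)
    with stopped_hit[of j "\<lambda>j. w (real j * (1 / 2 ^ k))" B J "1 / 2 ^ k" f] j show ?case by simp
  qed
  then have "liminf (stopped (1 / 2 ^ k) f B (\<lambda>j. w (real j * (1 / 2 ^ k)))) =
      ennreal (exp (- (real j / 2 ^ k))) * f (w (real j / 2 ^ k))"
    by (subst Liminf_eq) (auto simp: Liminf_const)
  ultimately show ?thesis by simp
next
  case False
  then have "grid_time k w B = \<infinity>" by (auto simp: grid_time_def)
  then show ?thesis by simp
qed

text \<open>Fatou's lemma, with no monotonicity required: it serves both for grid times that
  decrease under refinement and for times that increase as neighbourhoods shrink.\<close>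

lemma (in prob_space) nn_integral_discounted_limit:
  assumes W: "\<And>t. 0 \<le> t \<Longrightarrow> W t \<in> borel_measurable M" "\<And>\<omega>. \<omega> \<in> space M \<Longrightarrow> continuous_on {0..} (\<lambda>t. W t \<omega>)"
    and f: "f \<in> borel_measurable borel" "lower_semicontinuous f"
    and \<sigma>: "\<And>n. \<sigma> n \<in> borel_measurable M" "\<And>n \<omega>. 0 \<le> \<sigma> n \<omega>" "\<And>\<omega>. (\<lambda>n. \<sigma> n \<omega>) \<longlonglongrightarrow> \<tau> \<omega>"
    and le: "\<And>n. (\<integral>\<^sup>+\<omega>. discount (\<sigma> n \<omega>) * f (W (real_of_ereal (\<sigma> n \<omega>)) \<omega>) \<partial>M) \<le> c"
  shows "(\<integral>\<^sup>+\<omega>. discount (\<tau> \<omega>) * f (W (real_of_ereal (\<tau> \<omega>)) \<omega>) \<partial>M) \<le> c"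
proof -
  have [measurable]: "(\<lambda>\<omega>. W (real_of_ereal (\<sigma> n \<omega>)) \<omega>) \<in> borel_measurable M" for n
    using W by (rule path_value_measurable) (use \<sigma> in \<open>auto intro: real_of_ereal_pos\<close>)
  note [measurable] = f(1) \<sigma>(1)
  have "(\<integral>\<^sup>+\<omega>. discount (\<tau> \<omega>) * f (W (real_of_ereal (\<tau> \<omega>)) \<omega>) \<partial>M)
     \<le> (\<integral>\<^sup>+\<omega>. liminf (\<lambda>n. discount (\<sigma> n \<omega>) * f (W (real_of_ereal (\<sigma> n \<omega>)) \<omega>)) \<partial>M)"
    by (intro nn_integral_mono discounted_value_liminf[where w = "\<lambda>t. W t _"] W f \<sigma>)
  also have "\<dots> \<le> liminf (\<lambda>n. \<integral>\<^sup>+\<omega>. discount (\<sigma> n \<omega>) * f (W (real_of_ereal (\<sigma> n \<omega>)) \<omega>) \<partial>M)"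
    by (rule nn_integral_liminf) measurable
  also have "\<dots> \<le> liminf (\<lambda>n. c)"
    by (intro Liminf_mono always_eventually allI le)
  finally show ?thesis by (simp add: Liminf_const)
qed

text \<open>Three successive limits preserve the bound \<open>f y\<close>: infinitely many steps on
  a fixed grid, refinement of the grid, and shrinking of the neighbourhoods to
  \<open>A\<close>.\<close>

lemma (in prob_space) optional_stopping:
  assumes BM: "planar_brownian_motion M W" and f: "excessive f" and A: "closed A" "A \<noteq> {}"
  shows "(\<integral>\<^sup>+\<omega>. discount (hitting_time (\<lambda>t. y + W t \<omega>) A) *
            f (y + W (real_of_ereal (hitting_time (\<lambda>t. y + W t \<omega>) A)) \<omega>) \<partial>M) \<le> f y"
proof -
  let ?w = "\<lambda>t \<omega>. y + W t \<omega>"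
  have w: "0 \<le> t \<Longrightarrow> ?w t \<in> borel_measurable M" for t
    using planar_brownian_motionD(1)[OF BM] by simp
  have c: "\<omega> \<in> space M \<Longrightarrow> continuous_on {0..} (\<lambda>t. ?w t \<omega>)" for \<omega>
    using planar_brownian_motionD(3)[OF BM] by (intro continuous_intros)
  have f1 [measurable]: "f \<in> borel_measurable borel" and f2: "lower_semicontinuous f"
    using f by (auto simp: excessive_def)
  have grid: "(\<integral>\<^sup>+\<omega>. discount (grid_time k (\<lambda>t. ?w t \<omega>) B) * f (?w (real_of_ereal (grid_time k (\<lambda>t. ?w t \<omega>) B)) \<omega>) \<partial>M) \<le> f y"
    if [measurable]: "B \<in> sets borel" for k B
  proof -
    let ?s = "\<lambda>J \<omega>. stopped (1 / 2 ^ k) f B (\<lambda>j. ?w (real j * (1 / 2 ^ k)) \<omega>) J"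
    have [measurable]: "(\<lambda>\<omega>. ?w (real j * (1 / 2 ^ k)) \<omega>) \<in> borel_measurable M" for j by (rule w) simp
    have "(\<integral>\<^sup>+\<omega>. discount (grid_time k (\<lambda>t. ?w t \<omega>) B) * f (?w (real_of_ereal (grid_time k (\<lambda>t. ?w t \<omega>) B)) \<omega>) \<partial>M)
        \<le> (\<integral>\<^sup>+\<omega>. liminf (\<lambda>J. ?s J \<omega>) \<partial>M)"
      by (intro nn_integral_mono grid_time_stopped)
    also have "\<dots> \<le> liminf (\<lambda>J. \<integral>\<^sup>+\<omega>. ?s J \<omega> \<partial>M)"
      by (rule nn_integral_liminf) measurable
    also have "\<dots> \<le> liminf (\<lambda>J. f y)"
      by (intro Liminf_mono always_eventually allI nn_integral_stopped_le[OF BM f]) auto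
    finally show ?thesis by (simp add: Liminf_const)
  qed
  have dyadic: "(\<integral>\<^sup>+\<omega>. discount (dyadic_time (\<lambda>t. ?w t \<omega>) B) * f (?w (real_of_ereal (dyadic_time (\<lambda>t. ?w t \<omega>) B)) \<omega>) \<partial>M) \<le> f y"
    if B: "B \<in> sets borel" for B
    using w c f1 f2 grid_time_measurable[OF w B] _ grid_time_tendsto grid[OF B]
    by (rule nn_integral_discounted_limit) auto
  have "(\<integral>\<^sup>+\<omega>. discount (dyadic_hitting_time (\<lambda>t. ?w t \<omega>) A) *
      f (?w (real_of_ereal (dyadic_hitting_time (\<lambda>t. ?w t \<omega>) A)) \<omega>) \<partial>M) \<le> f y"
    using w c f1 f2 dyadic_time_measurable[OF w nbhd_measurable] _ dyadic_time_nbhd_tendsto dyadic[OF nbhd_measurable]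
    by (rule nn_integral_discounted_limit) auto
  also have "(\<integral>\<^sup>+\<omega>. discount (dyadic_hitting_time (\<lambda>t. ?w t \<omega>) A) *
      f (?w (real_of_ereal (dyadic_hitting_time (\<lambda>t. ?w t \<omega>) A)) \<omega>) \<partial>M) =
    (\<integral>\<^sup>+\<omega>. discount (hitting_time (\<lambda>t. ?w t \<omega>) A) * f (?w (real_of_ereal (hitting_time (\<lambda>t. ?w t \<omega>) A)) \<omega>) \<partial>M)"
    by (intro nn_integral_cong) (simp add: hitting_time_eq_dyadic c A)
  finally show ?thesis .
qed

subsection \<open>Exit from a wedge\<close>

lemma Theta_bounds:
  assumes "0 < \<alpha>"
  shows "0 < Theta \<alpha>" "Theta \<alpha> \<le> pi"
proof -
  show "0 < Theta \<alpha>" using Theta_is_max(1)[OF assms] by auto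
  from Theta_is_max(1)[OF assms] obtain m :: nat where m: "1 \<le> m" "Theta \<alpha> = pi / real m" by auto
  have "pi / real m \<le> pi / 1" by (rule divide_left_mono) (use m in auto)
  with m show "Theta \<alpha> \<le> pi" by simp
qed

lemma sin_half_Theta_pos: "0 < \<alpha> \<Longrightarrow> 0 < sin (Theta \<alpha> / 2)"
  using Theta_bounds[of \<alpha>] by (intro sin_gt_zero) auto

lemma wedge_rotate: "wedge (\<theta> + a) (\<theta> + b) = (*) (cis \<theta>) ` wedge a b"
proof (intro set_eqI iffI)
  fix z assume "z \<in> wedge (\<theta> + a) (\<theta> + b)"
  then obtain r \<phi> where "z = rcis r \<phi>" "0 \<le> r" "\<phi> \<in> {\<theta> + a..\<theta> + b}" by (auto simp: wedge_def)
  then have "z = cis \<theta> * rcis r (\<phi> - \<theta>)" by (simp add: rcis_def cis_mult)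
  moreover have "rcis r (\<phi> - \<theta>) \<in> wedge a b"
    unfolding wedge_def mem_Collect_eq using \<open>0 \<le> r\<close> \<open>\<phi> \<in> _\<close>
    by (intro exI[of _ r] exI[of _ "\<phi> - \<theta>"]) auto
  ultimately show "z \<in> (*) (cis \<theta>) ` wedge a b" by (rule image_eqI)
next
  fix z assume "z \<in> (*) (cis \<theta>) ` wedge a b"
  then obtain r \<phi> where "z = cis \<theta> * rcis r \<phi>" "0 \<le> r" "\<phi> \<in> {a..b}" by (auto simp: wedge_def)
  then show "z \<in> wedge (\<theta> + a) (\<theta> + b)"
    unfolding wedge_def mem_Collect_eq
    by (intro exI[of _ r] exI[of _ "\<theta> + \<phi>"]) (simp add: rcis_def cis_mult)
qed

text \<open>Rotation is an injective linear map of the plane and therefore commutes with closure and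
  interior.\<close>

lemma frontier_wedge_rotate:
  "z \<in> frontier (wedge (\<theta> + a) (\<theta> + b)) \<longleftrightarrow> cis (- \<theta>) * z \<in> frontier (wedge a b)"
proof -
  have inj: "inj ((*) (cis \<theta>))" and lin: "linear ((*) (cis \<theta>))"
    by (auto simp: inj_on_def intro!: bounded_linear.linear bounded_linear_mult_right)
  have "frontier (wedge (\<theta> + a) (\<theta> + b)) = (*) (cis \<theta>) ` frontier (wedge a b)"
    unfolding wedge_rotate frontier_def
    by (simp add: closure_injective_linear_image[OF lin inj] interior_injective_linear_image[OF lin inj]
        image_set_diff[OF inj])
  moreover have "z = cis \<theta> * (cis (- \<theta>) * z)" "cis (- \<theta>) * (cis \<theta> * y) = y" for y
    by (simp_all add: mult.assoc[symmetric] cis_mult)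
  ultimately show ?thesis by (metis image_iff)
qed

definition wedge_boundary :: "real \<Rightarrow> complex set" where
  "wedge_boundary \<alpha> = frontier (wedge (- (Theta \<alpha> / 2)) (Theta \<alpha> / 2))"

text \<open>The angle is moved from the target set into the path. With a fixed target, measurability
  in a random angle reduces to that of the rotated path.\<close>

lemma exit_time_eq: "exit_time \<alpha> \<theta> w = hitting_time (\<lambda>t. cis (- \<theta>) * w t) (wedge_boundary \<alpha>)"
  using frontier_wedge_rotate[of _ \<theta> "- (Theta \<alpha> / 2)" "Theta \<alpha> / 2"]
  unfolding exit_time_def hitting_time_def wedge_boundary_def by simp

lemma closed_wedge_boundary: "closed (wedge_boundary \<alpha>)"
  unfolding wedge_boundary_def by (rule frontier_closed)

text \<open>The opening angle is at most \<open>pi\<close>, so the wedge lies in the right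
  half-plane. It contains 0 but not -1, and a nonempty proper subset of the connected plane has a
  frontier.\<close>

lemma wedge_boundary_nonempty:
  assumes "0 < \<alpha>"
  shows "wedge_boundary \<alpha> \<noteq> {}"
proof -
  have "0 \<le> Re z" if "z \<in> wedge (- (Theta \<alpha> / 2)) (Theta \<alpha> / 2)" for z
  proof -
    from that obtain r \<phi> where "z = rcis r \<phi>" "0 \<le> r" "\<phi> \<in> {- (Theta \<alpha> / 2)..Theta \<alpha> / 2}"
      by (auto simp: wedge_def)
    moreover from this have "0 \<le> cos \<phi>" using Theta_bounds[OF assms] by (intro cos_ge_zero) auto
    ultimately show ?thesis by simp
  qed
  from this[of "-1"] have "-1 \<notin> wedge (- (Theta \<alpha> / 2)) (Theta \<alpha> / 2)" by auto
  moreover have "rcis 0 0 \<in> wedge (- (Theta \<alpha> / 2)) (Theta \<alpha> / 2)"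
    unfolding wedge_def using Theta_bounds[OF assms] by fastforce
  ultimately show ?thesis
    unfolding wedge_boundary_def frontier_eq_empty by auto
qed

text \<open>Law of cosines: a point whose argument exceeds \<open>a\<close> in absolute value has
  distance at least \<open>r * sin a\<close> from the point \<open>r\<close> on the axis.\<close>

lemma ball_subset_wedge:
  assumes "0 \<le> r" "0 \<le> a" "a \<le> pi"
  shows "ball (complex_of_real r) (r * sin a) \<subseteq> wedge (- a) a"
proof
  fix z assume "z \<in> ball (complex_of_real r) (r * sin a)"
  then have lt: "cmod (z - of_real r) < r * sin a" by (simp add: dist_norm norm_minus_commute)
  have "\<bar>Arg z\<bar> \<le> a"
  proof (rule ccontr)
    assume "\<not> \<bar>Arg z\<bar> \<le> a"
    then have "cos \<bar>Arg z\<bar> \<le> cos a"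
      using assms Arg_bounded[of z] by (intro cos_monotone_0_pi_le) auto
    then have cos: "cos (Arg z) \<le> cos a" by simp
    have z: "Re z = cmod z * cos (Arg z)" using rcis_cmod_Arg[of z] Re_rcis by metis
    \<comment> \<open>The added square completes
      \<open>r\<^sup>2 + (cmod z)\<^sup>2 - 2 * r * cmod z * cos a\<close>; it vanishes at the foot
      of the perpendicular from \<open>r\<close> to the ray of angle \<open>a\<close>.\<close>
    have "(r * sin a)\<^sup>2 \<le> (r * sin a)\<^sup>2 + (cmod z - r * cos a)\<^sup>2" by simp
    also have "\<dots> = r\<^sup>2 * ((sin a)\<^sup>2 + (cos a)\<^sup>2) + (cmod z)\<^sup>2 - 2 * (r * cmod z) * cos a"
      by algebra
    also have "\<dots> = r\<^sup>2 + (cmod z)\<^sup>2 - 2 * (r * cmod z) * cos a"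
      by simp
    also have "\<dots> \<le> r\<^sup>2 + (cmod z)\<^sup>2 - 2 * (r * cmod z) * cos (Arg z)"
      using cos assms by (intro diff_left_mono mult_left_mono) auto
    also have "\<dots> = r\<^sup>2 + (cmod z)\<^sup>2 - 2 * r * Re z" using z by simp
    also have "\<dots> = (cmod (z - of_real r))\<^sup>2"
      unfolding cmod_power2 by (simp add: power2_eq_square algebra_simps)
    finally have "(r * sin a)\<^sup>2 \<le> (cmod (z - of_real r))\<^sup>2" .
    then have "r * sin a \<le> cmod (z - of_real r)" by (rule power2_le_imp_le) simp
    with lt show False by simp
  qed
  then have "Arg z \<in> {- a..a}" by (auto simp: abs_le_iff)
  then show "z \<in> wedge (- a) a"
    unfolding wedge_def using rcis_cmod_Arg[of z] by (metis (mono_tags, lifting) mem_Collect_eq norm_ge_zero)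
qed

lemma dist_wedge_boundary:
  assumes "0 < \<alpha>" "0 \<le> r" "cis (- \<theta>) * z \<in> wedge_boundary \<alpha>"
  shows "r * sin (Theta \<alpha> / 2) \<le> cmod (z - rcis r \<theta>)"
proof (rule ccontr)
  assume "\<not> ?thesis"
  moreover have "cmod (z - rcis r \<theta>) = cmod (cis (- \<theta>) * (z - rcis r \<theta>))" by (simp add: norm_mult)
  moreover have "cis (- \<theta>) * (z - rcis r \<theta>) = cis (- \<theta>) * z - of_real r"
    by (simp add: rcis_def cis_mult algebra_simps)
  ultimately have "cis (- \<theta>) * z \<in> ball (complex_of_real r) (r * sin (Theta \<alpha> / 2))"
    by (simp add: dist_norm norm_minus_commute)
  moreover have "ball (complex_of_real r) (r * sin (Theta \<alpha> / 2)) \<subseteq> interior (wedge (- (Theta \<alpha> / 2)) (Theta \<alpha> / 2))"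
    using Theta_bounds[OF assms(1)] assms by (intro interior_maximal ball_subset_wedge) auto
  ultimately show False using assms(3) by (auto simp: wedge_boundary_def frontier_def)
qed

text \<open>The reciprocal of the quadratic excessive function at the distance bound from
  \<open>dist_wedge_boundary\<close>, that is, the factor that makes this function at least 1 on the
  boundary.\<close>

definition exit_discount :: "real \<Rightarrow> real \<Rightarrow> real" where
  "exit_discount \<alpha> r = 1 / (1 + (r * sin (Theta \<alpha> / 2))\<^sup>2 / 2)"

lemma exit_discount_bounds [simp]: "0 \<le> exit_discount \<alpha> r" "exit_discount \<alpha> r \<le> 1"
  by (simp_all add: exit_discount_def add_pos_nonneg)

lemma exit_time_nonneg [simp]: "0 \<le> exit_time \<alpha> \<theta> w"
  by (simp add: exit_time_def)

context prob_space
begin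

lemma exit_optional_stopping:
  assumes "planar_brownian_motion M W" "0 < \<alpha>" "excessive f"
  shows "(\<integral>\<^sup>+\<omega>. discount (exit_time \<alpha> \<theta> (\<lambda>t. y + W t \<omega>)) * f (exit_point \<alpha> \<theta> (\<lambda>t. y + W t \<omega>)) \<partial>M) \<le> f y"
proof -
  let ?A = "frontier (wedge (\<theta> - Theta \<alpha> / 2) (\<theta> + Theta \<alpha> / 2))"
  obtain b where b: "b \<in> wedge_boundary \<alpha>" using wedge_boundary_nonempty[OF assms(2)] by auto
  have "cis \<theta> * b \<in> ?A"
    using frontier_wedge_rotate[of "cis \<theta> * b" \<theta> "- (Theta \<alpha> / 2)" "Theta \<alpha> / 2"] b
    by (simp add: wedge_boundary_def mult.assoc[symmetric] cis_mult)
  then have "?A \<noteq> {}" by auto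
  from optional_stopping[OF assms(1,3) frontier_closed this] show ?thesis
    unfolding exit_point_def exit_time_def .
qed

text \<open>Optional stopping for the scaled quadratic centred at the starting point: it is at least
  1 at the exit point and equals \<open>exit_discount \<alpha> r\<close> at the start.\<close>

lemma exit_discount_bound:
  assumes BM: "planar_brownian_motion M W" and \<alpha>: "0 < \<alpha>" and r: "0 \<le> r"
  shows "(\<integral>\<^sup>+\<omega>. discount (exit_time \<alpha> \<theta> (\<lambda>t. rcis r \<theta> + W t \<omega>)) \<partial>M) \<le> ennreal (exit_discount \<alpha> r)"
proof -
  let ?a = "exit_discount \<alpha> r" and ?y = "rcis r \<theta>"
  let ?f = "\<lambda>x. ennreal (?a * (1 + (cmod (x - ?y))\<^sup>2 / 2))"
  let ?\<tau> = "\<lambda>\<omega>. exit_time \<alpha> \<theta> (\<lambda>t. ?y + W t \<omega>)"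
  have "(\<integral>\<^sup>+\<omega>. discount (?\<tau> \<omega>) \<partial>M) \<le> (\<integral>\<^sup>+\<omega>. discount (?\<tau> \<omega>) * ?f (exit_point \<alpha> \<theta> (\<lambda>t. ?y + W t \<omega>)) \<partial>M)"
  proof (rule nn_integral_mono)
    fix \<omega> assume \<omega>: "\<omega> \<in> space M"
    show "discount (?\<tau> \<omega>) \<le> discount (?\<tau> \<omega>) * ?f (exit_point \<alpha> \<theta> (\<lambda>t. ?y + W t \<omega>))"
    proof (cases "?\<tau> \<omega> = \<infinity>")
      case False
      have "continuous_on {0..} (\<lambda>t. cis (- \<theta>) * (?y + W t \<omega>))"
        using planar_brownian_motionD(3)[OF BM \<omega>] by (intro continuous_intros)
      from hitting_time_in[OF this closed_wedge_boundary wedge_boundary_nonempty[OF \<alpha>]] False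
      have "cis (- \<theta>) * exit_point \<alpha> \<theta> (\<lambda>t. ?y + W t \<omega>) \<in> wedge_boundary \<alpha>"
        by (simp add: exit_point_def exit_time_eq)
      from dist_wedge_boundary[OF \<alpha> r this]
      have "(r * sin (Theta \<alpha> / 2))\<^sup>2 \<le> (cmod (exit_point \<alpha> \<theta> (\<lambda>t. ?y + W t \<omega>) - ?y))\<^sup>2"
        using r sin_half_Theta_pos[OF \<alpha>] by (intro power_mono) auto
      then have "1 \<le> ?a * (1 + (cmod (exit_point \<alpha> \<theta> (\<lambda>t. ?y + W t \<omega>) - ?y))\<^sup>2 / 2)"
        by (simp add: exit_discount_def le_divide_eq add_pos_nonneg)
      then have "1 \<le> ?f (exit_point \<alpha> \<theta> (\<lambda>t. ?y + W t \<omega>))" by simp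
      from mult_left_mono[OF this, of "discount (?\<tau> \<omega>)"] show ?thesis by simp
    qed simp
  qed
  also have "\<dots> \<le> ?f ?y" by (intro exit_optional_stopping BM \<alpha> excessive_quadratic) simp
  finally show ?thesis by simp
qed

end

subsection \<open>Algorithm II\<close>

definition elapsed :: "real \<Rightarrow> real \<Rightarrow> real \<Rightarrow> (nat \<Rightarrow> real \<Rightarrow> complex) \<Rightarrow> nat \<Rightarrow> ereal" where
  "elapsed \<alpha> r0 \<theta>0 \<zeta> n = (\<Sum>i<n. duration \<alpha> r0 \<theta>0 \<zeta> i)"

lemma duration_nonneg [simp]: "0 \<le> duration \<alpha> r0 \<theta>0 \<zeta> n"
  by (simp add: duration_def)

lemma elapsed_nonneg [simp]: "0 \<le> elapsed \<alpha> r0 \<theta>0 \<zeta> n"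
  unfolding elapsed_def by (intro sum_nonneg) simp

lemma elapsed_Suc: "elapsed \<alpha> r0 \<theta>0 \<zeta> (Suc n) = elapsed \<alpha> r0 \<theta>0 \<zeta> n + duration \<alpha> r0 \<theta>0 \<zeta> n"
  by (simp add: elapsed_def)

lemma radius_nonneg: "0 \<le> r0 \<Longrightarrow> 0 \<le> fst (polar \<alpha> r0 \<theta>0 \<zeta> n)"
  by (cases n) (auto simp: Let_def)

lemma radius_Suc: "fst (polar \<alpha> r0 \<theta>0 \<zeta> (Suc n)) = cmod (exit_point \<alpha> (snd (polar \<alpha> r0 \<theta>0 \<zeta> n)) (\<zeta> n))"
  by (simp add: Let_def)

lemma rcis_measurable [measurable]:
  assumes [measurable]: "f \<in> borel_measurable M" "g \<in> borel_measurable M"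
  shows "(\<lambda>x. rcis (f x) (g x)) \<in> borel_measurable M"
proof -
  have "rcis (f x) (g x) = Complex (f x * cos (g x)) (f x * sin (g x))" for x
    by (simp add: complex_eq_iff)
  then show ?thesis by simp
qed

lemma cis_measurable [measurable]:
  assumes [measurable]: "g \<in> borel_measurable M"
  shows "(\<lambda>x. cis (g x)) \<in> borel_measurable M"
  using rcis_measurable[OF borel_measurable_const[of 1] assms] by (simp add: rcis_def)

lemma exit_time_measurable:
  fixes w :: "real \<Rightarrow> 'a \<Rightarrow> complex"
  assumes \<alpha>: "0 < \<alpha>" and \<theta> [measurable]: "\<theta> \<in> borel_measurable N"
    and w: "\<And>t. 0 \<le> t \<Longrightarrow> w t \<in> borel_measurable N"
    and c: "\<And>\<omega>. \<omega> \<in> space N \<Longrightarrow> continuous_on {0..} (\<lambda>t. w t \<omega>)"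
  shows "(\<lambda>\<omega>. exit_time \<alpha> (\<theta> \<omega>) (\<lambda>t. w t \<omega>)) \<in> borel_measurable N"
    and "(\<lambda>\<omega>. exit_point \<alpha> (\<theta> \<omega>) (\<lambda>t. w t \<omega>)) \<in> borel_measurable N"
proof -
  have 1: "exit_time \<alpha> (\<theta> \<omega>) (\<lambda>t. w t \<omega>) = dyadic_hitting_time (\<lambda>t. cis (- \<theta> \<omega>) * w t \<omega>) (wedge_boundary \<alpha>)"
    if "\<omega> \<in> space N" for \<omega>
    unfolding exit_time_eq
    by (intro hitting_time_eq_dyadic closed_wedge_boundary wedge_boundary_nonempty \<alpha> continuous_intros c that)
  have "(\<lambda>\<omega>. cis (- \<theta> \<omega>) * w t \<omega>) \<in> borel_measurable N" if "0 \<le> t" for t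
    using w[OF that] by measurable
  from dyadic_hitting_time_measurable[OF this]
  show t: "(\<lambda>\<omega>. exit_time \<alpha> (\<theta> \<omega>) (\<lambda>t. w t \<omega>)) \<in> borel_measurable N"
    by (subst measurable_cong[OF 1])
  show "(\<lambda>\<omega>. exit_point \<alpha> (\<theta> \<omega>) (\<lambda>t. w t \<omega>)) \<in> borel_measurable N"
    unfolding exit_point_def using w c
    by (rule path_value_measurable) (use t in \<open>auto intro: real_of_ereal_pos\<close>)
qed

text \<open>The state after \<open>k\<close> steps uses only the paths with index below
  \<open>k\<close>. Measurability of \<open>Z\<close> is therefore asked below \<open>n\<close>
  only, so that \<open>N\<close> can be the sigma-algebra of the past.\<close>

lemma polar_measurable:
  fixes Z :: "nat \<Rightarrow> real \<Rightarrow> 'a \<Rightarrow> complex"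
  assumes \<alpha>: "0 < \<alpha>"
    and Z: "\<And>k t. k < n \<Longrightarrow> 0 \<le> t \<Longrightarrow> Z k t \<in> borel_measurable N"
    and c: "\<And>k \<omega>. \<omega> \<in> space N \<Longrightarrow> continuous_on {0..} (\<lambda>t. Z k t \<omega>)"
  shows "k \<le> n \<Longrightarrow> (\<lambda>\<omega>. fst (polar \<alpha> r0 \<theta>0 (\<lambda>k t. Z k t \<omega>) k)) \<in> borel_measurable N \<and>
      (\<lambda>\<omega>. snd (polar \<alpha> r0 \<theta>0 (\<lambda>k t. Z k t \<omega>) k)) \<in> borel_measurable N \<and>
      (\<lambda>\<omega>. elapsed \<alpha> r0 \<theta>0 (\<lambda>k t. Z k t \<omega>) k) \<in> borel_measurable N"
proof (induction k)
  case 0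
  then show ?case by (simp add: elapsed_def)
next
  case (Suc k)
  let ?\<theta> = "\<lambda>\<omega>. snd (polar \<alpha> r0 \<theta>0 (\<lambda>k t. Z k t \<omega>) k)"
  from Suc have [measurable]: "?\<theta> \<in> borel_measurable N"
      "(\<lambda>\<omega>. elapsed \<alpha> r0 \<theta>0 (\<lambda>k t. Z k t \<omega>) k) \<in> borel_measurable N" by auto
  have Zk: "0 \<le> t \<Longrightarrow> Z k t \<in> borel_measurable N" for t using Suc Z by simp
  have [measurable]: "(\<lambda>\<omega>. exit_time \<alpha> (?\<theta> \<omega>) (\<lambda>t. Z k t \<omega>)) \<in> borel_measurable N"
    "(\<lambda>\<omega>. exit_point \<alpha> (?\<theta> \<omega>) (\<lambda>t. Z k t \<omega>)) \<in> borel_measurable N"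
    by (rule exit_time_measurable[OF \<alpha> _ Zk c], measurable)+
  have [measurable]: "(\<lambda>\<omega>. exit_angle \<alpha> (?\<theta> \<omega>) (\<lambda>t. Z k t \<omega>)) \<in> borel_measurable N"
    unfolding exit_angle_def Let_def by measurable
  have "(\<lambda>\<omega>. fst (polar \<alpha> r0 \<theta>0 (\<lambda>k t. Z k t \<omega>) (Suc k))) \<in> borel_measurable N"
    unfolding radius_Suc by measurable
  moreover have "(\<lambda>\<omega>. snd (polar \<alpha> r0 \<theta>0 (\<lambda>k t. Z k t \<omega>) (Suc k))) \<in> borel_measurable N"
    by (simp add: Let_def fold_angle_def)
  moreover have "(\<lambda>\<omega>. elapsed \<alpha> r0 \<theta>0 (\<lambda>k t. Z k t \<omega>) (Suc k)) \<in> borel_measurable N"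
    unfolding elapsed_Suc duration_def by measurable
  ultimately show ?case by blast
qed

text \<open>Translates independence of sigma-algebras, as in \<open>drives_algorithm_II\<close>,
  into the form that \<open>nn_integral_product_law\<close> takes; rectangles suffice to compare the
  two laws.\<close>

lemma (in prob_space) product_law_indep_vimage:
  assumes "indep_set (sets F) (sets (vimage_algebra (space M) Y T))"
    and F: "space F = space M" and X: "X \<in> measurable F S" and Y: "Y \<in> space M \<rightarrow> space T"
  shows "X \<in> measurable M S" "Y \<in> measurable M T"
    "distr M S X \<Otimes>\<^sub>M distr M T Y = distr M (S \<Otimes>\<^sub>M T) (\<lambda>\<omega>. (X \<omega>, Y \<omega>))"
proof -
  let ?V = "vimage_algebra (space M) Y T"
  have ind: "sets F \<subseteq> events" "sets ?V \<subseteq> events"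
    "\<And>a b. a \<in> sets F \<Longrightarrow> b \<in> sets ?V \<Longrightarrow> prob (a \<inter> b) = prob a * prob b"
    using assms(1) by (auto simp: indep_sets2_eq)
  have YV: "Y \<in> measurable ?V T" using Y by (rule measurable_vimage_algebra1)
  show XM [measurable]: "X \<in> measurable M S" using X ind(1) F by (auto simp: measurable_def)
  show YM [measurable]: "Y \<in> measurable M T" using YV ind(2) by (auto simp: measurable_def)
  interpret X: prob_space "distr M S X" by (rule prob_space_distr) measurable
  interpret Y: prob_space "distr M T Y" by (rule prob_space_distr) measurable
  show "distr M S X \<Otimes>\<^sub>M distr M T Y = distr M (S \<Otimes>\<^sub>M T) (\<lambda>\<omega>. (X \<omega>, Y \<omega>))"
  proof (rule pair_measure_eqI)
    show "sigma_finite_measure (distr M S X)" "sigma_finite_measure (distr M T Y)" by unfold_locales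
    have "sets (distr M S X \<Otimes>\<^sub>M distr M T Y) = sets (S \<Otimes>\<^sub>M T)"
      by (rule sets_pair_measure_cong) simp_all
    then show "sets (distr M S X \<Otimes>\<^sub>M distr M T Y) = sets (distr M (S \<Otimes>\<^sub>M T) (\<lambda>\<omega>. (X \<omega>, Y \<omega>)))"
      by simp
    fix A B assume "A \<in> sets (distr M S X)" "B \<in> sets (distr M T Y)"
    then have [measurable]: "A \<in> sets S" "B \<in> sets T" by auto
    have a: "X -` A \<inter> space M \<in> sets F" using X F by (metis \<open>A \<in> sets S\<close> measurable_sets)
    have b: "Y -` B \<inter> space M \<in> sets ?V" by (rule in_vimage_algebra) fact
    have "emeasure (distr M (S \<Otimes>\<^sub>M T) (\<lambda>\<omega>. (X \<omega>, Y \<omega>))) (A \<times> B)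
        = emeasure M ((X -` A \<inter> space M) \<inter> (Y -` B \<inter> space M))"
      by (subst emeasure_distr) (auto intro!: arg_cong[where f = "emeasure M"])
    also have "\<dots> = emeasure M (X -` A \<inter> space M) * emeasure M (Y -` B \<inter> space M)"
      using ind(3)[OF a b] by (simp add: emeasure_eq_measure ennreal_mult)
    finally show "emeasure (distr M S X) A * emeasure (distr M T Y) B
        = emeasure (distr M (S \<Otimes>\<^sub>M T) (\<lambda>\<omega>. (X \<omega>, Y \<omega>))) (A \<times> B)"
      by (simp add: emeasure_distr)
  qed
qed

section \<open>The states of the algorithm, their adaptedness and the one-step estimate\<close>

locale algorithm_II = prob_space M
  for M :: "'a measure" and Z :: "nat \<Rightarrow> real \<Rightarrow> 'a \<Rightarrow> complex" and \<alpha> r0 \<theta>0 :: real +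
  assumes \<alpha>: "0 < \<alpha>" and r0: "0 < r0" and drives: "drives_algorithm_II M \<alpha> r0 \<theta>0 Z"
begin

abbreviation \<zeta> :: "'a \<Rightarrow> nat \<Rightarrow> real \<Rightarrow> complex" where "\<zeta> \<omega> \<equiv> (\<lambda>k t. Z k t \<omega>)"

definition R :: "nat \<Rightarrow> 'a \<Rightarrow> real" where "R n \<omega> = fst (polar \<alpha> r0 \<theta>0 (\<zeta> \<omega>) n)"

definition angle :: "nat \<Rightarrow> 'a \<Rightarrow> real" where "angle n \<omega> = snd (polar \<alpha> r0 \<theta>0 (\<zeta> \<omega>) n)"

definition time :: "nat \<Rightarrow> 'a \<Rightarrow> ereal" where "time n \<omega> = elapsed \<alpha> r0 \<theta>0 (\<zeta> \<omega>) n"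

definition W :: "nat \<Rightarrow> real \<Rightarrow> 'a \<Rightarrow> complex" where
  "W n t \<omega> = Z n t \<omega> - position \<alpha> r0 \<theta>0 (\<zeta> \<omega>) n"

definition past :: "nat \<Rightarrow> 'a measure" where
  "past n = vimage_algebra (space M) (\<lambda>\<omega>. \<lambda>(k, t)\<in>{..<n} \<times> {0..}. Z k t \<omega>) (PiM ({..<n} \<times> {0..}) (\<lambda>_. borel))"

lemma space_past [simp]: "space (past n) = space M"
  by (simp add: past_def)

lemma Z_eq: "Z n t \<omega> = rcis (R n \<omega>) (angle n \<omega>) + W n t \<omega>"
  by (simp add: W_def position_def R_def angle_def)

lemma R_nonneg [simp]: "0 \<le> R n \<omega>"
  unfolding R_def using r0 by (intro radius_nonneg) simp

lemma time_nonneg [simp]: "0 \<le> time n \<omega>"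
  by (simp add: time_def)

lemma brownian_W: "planar_brownian_motion M (W n)"
  using drives unfolding drives_algorithm_II_def Let_def W_def[abs_def] by blast

lemma indep_past:
  "indep_set (sets (past n)) (sets (vimage_algebra (space M) (\<lambda>\<omega>. \<lambda>t\<in>{0..}. W n t \<omega>) (PiM {0..} (\<lambda>_. borel))))"
  using drives unfolding drives_algorithm_II_def Let_def past_def W_def[abs_def] by blast

lemma past_subset: "sets (past n) \<subseteq> events"
  using indep_past by (simp add: indep_sets2_eq)

lemma Z_continuous: "\<omega> \<in> space M \<Longrightarrow> continuous_on {0..} (\<lambda>t. Z n t \<omega>)"
  unfolding ext[OF Z_eq[of n _ \<omega>]] using planar_brownian_motionD(3)[OF brownian_W] by (intro continuous_intros)

lemma Z_measurable_past:
  assumes "k < n" "0 \<le> t"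
  shows "Z k t \<in> borel_measurable (past n)"
proof -
  have "(\<lambda>\<omega>. \<lambda>(k, t)\<in>{..<n} \<times> {0..}. Z k t \<omega>) \<in> measurable (past n) (PiM ({..<n} \<times> {0..}) (\<lambda>_. borel))"
    unfolding past_def by (rule measurable_vimage_algebra1) (auto simp: space_PiM)
  from measurable_compose[OF this measurable_component_singleton[of "(k, t)"]] assms
  show ?thesis by (simp add: case_prod_beta)
qed

lemma past_measurable:
  "R n \<in> borel_measurable (past n)" "angle n \<in> borel_measurable (past n)" "time n \<in> borel_measurable (past n)"
proof -
  have "\<omega> \<in> space (past n) \<Longrightarrow> continuous_on {0..} (\<lambda>t. Z k t \<omega>)" for k \<omega>
    using Z_continuous by simp
  from polar_measurable[OF \<alpha> Z_measurable_past this order_refl]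
  show "R n \<in> borel_measurable (past n)" "angle n \<in> borel_measurable (past n)" "time n \<in> borel_measurable (past n)"
    unfolding R_def[abs_def] angle_def[abs_def] time_def[abs_def] by auto
qed

lemma past_measurableD: "f \<in> measurable (past n) N \<Longrightarrow> f \<in> measurable M N"
  using past_subset[of n] by (auto simp: measurable_def)

lemmas process_measurable [measurable] = past_measurable[THEN past_measurableD]

lemma R_Suc: "R (Suc n) \<omega> = cmod (exit_point \<alpha> (angle n \<omega>) (\<zeta> \<omega> n))"
  unfolding R_def angle_def by (rule radius_Suc)

lemma time_Suc: "time (Suc n) \<omega> = time n \<omega> + exit_time \<alpha> (angle n \<omega>) (\<zeta> \<omega> n)"
  by (simp add: time_def angle_def elapsed_Suc duration_def)

text \<open>A Markov property in integrated form: a bound for one step from every deterministic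
  state transfers to the random state, because that state is measurable with respect to the past and
  \<open>W n\<close> is independent of it.\<close>

lemma nn_integral_step_le:
  assumes g [measurable]: "g \<in> borel_measurable borel" and b [measurable]: "b \<in> borel_measurable borel"
    and le: "\<And>r \<theta>. 0 \<le> r \<Longrightarrow>
      (\<integral>\<^sup>+\<omega>. discount (exit_time \<alpha> \<theta> (\<lambda>t. rcis r \<theta> + W n t \<omega>)) * g (cmod (exit_point \<alpha> \<theta> (\<lambda>t. rcis r \<theta> + W n t \<omega>))) \<partial>M) \<le> b r"
  shows "(\<integral>\<^sup>+\<omega>. discount (time (Suc n) \<omega>) * g (R (Suc n) \<omega>) \<partial>M) \<le> (\<integral>\<^sup>+\<omega>. discount (time n \<omega>) * b (R n \<omega>) \<partial>M)"
proof -
  let ?P = "PiM {0..} (\<lambda>_. borel) :: (real \<Rightarrow> complex) measure"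
  let ?S = "borel \<Otimes>\<^sub>M (borel \<Otimes>\<^sub>M borel) :: (ereal \<times> real \<times> real) measure"
  define X where "X \<omega> = (time n \<omega>, R n \<omega>, angle n \<omega>)" for \<omega>
  define Y where "Y \<omega> = (\<lambda>t\<in>{0..}. W n t \<omega>)" for \<omega>
  have "X \<in> measurable (past n) ?S"
    unfolding X_def using past_measurable by measurable
  moreover have "Y \<in> space M \<rightarrow> space ?P" by (auto simp: Y_def space_PiM)
  ultimately have law: "X \<in> measurable M ?S" "Y \<in> measurable M ?P"
      "distr M ?S X \<Otimes>\<^sub>M distr M ?P Y = distr M (?S \<Otimes>\<^sub>M ?P) (\<lambda>\<omega>. (X \<omega>, Y \<omega>))"
    using product_law_indep_vimage[OF indep_past[of n, folded Y_def[abs_def]] space_past] by blast+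
  \<comment> \<open>Exit time and exit radius as functionals of the state before the step and of the path; for a fixed
    state they can be integrated out by independence.\<close>
  define w where "w t p = rcis (fst (snd (fst p))) (snd (snd (fst p))) + snd p t"
    for t and p :: "(ereal \<times> real \<times> real) \<times> (real \<Rightarrow> complex)"
  define \<tau> where "\<tau> p = dyadic_hitting_time (\<lambda>t. cis (- snd (snd (fst p))) * w t p) (wedge_boundary \<alpha>)" for p
  define \<Phi> where "\<Phi> p = discount (fst (fst p)) *
      (discount (\<tau> p) * g (cmod (dyadic_value (\<lambda>t. w t p) (real_of_ereal (\<tau> p)))))" for p
  have w_meas: "w t \<in> borel_measurable (?S \<Otimes>\<^sub>M ?P)" if "0 \<le> t" for t
  proof -
    have [measurable]: "(\<lambda>p. snd p t) \<in> borel_measurable (?S \<Otimes>\<^sub>M ?P)"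
      using that by (intro measurable_compose[OF measurable_snd measurable_component_singleton]) auto
    show ?thesis unfolding w_def by measurable
  qed
  have \<tau>_meas [measurable]: "\<tau> \<in> borel_measurable (?S \<Otimes>\<^sub>M ?P)"
    unfolding \<tau>_def by (intro dyadic_hitting_time_measurable borel_measurable_times w_meas) measurable
  have [measurable]: "(\<lambda>p. dyadic_value (\<lambda>t. w t p) (real_of_ereal (\<tau> p))) \<in> borel_measurable (?S \<Otimes>\<^sub>M ?P)"
    by (intro dyadic_value_measurable w_meas) measurable
  have \<Phi>_meas: "\<Phi> \<in> borel_measurable (?S \<Otimes>\<^sub>M ?P)"
    unfolding \<Phi>_def by measurable
  \<comment> \<open>The dyadic functionals make \<Phi> measurable on all paths; only on continuous
    ones, such as those of \<open>W n\<close>, do they coincide with the exit quantities.\<close>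
  have \<Phi>_eq: "\<Phi> (X \<omega>, Y \<omega>') = discount (time n \<omega>) *
      (discount (exit_time \<alpha> (angle n \<omega>) (\<lambda>t. rcis (R n \<omega>) (angle n \<omega>) + W n t \<omega>')) *
       g (cmod (exit_point \<alpha> (angle n \<omega>) (\<lambda>t. rcis (R n \<omega>) (angle n \<omega>) + W n t \<omega>'))))"
    if "\<omega>' \<in> space M" for \<omega> \<omega>'
  proof -
    let ?w = "\<lambda>t. rcis (R n \<omega>) (angle n \<omega>) + W n t \<omega>'"
    have cont: "continuous_on {0..} ?w"
      using planar_brownian_motionD(3)[OF brownian_W that] by (intro continuous_intros)
    have w: "w t (X \<omega>, Y \<omega>') = ?w t" if "0 \<le> t" for t using that by (simp add: w_def X_def Y_def)
    have c': "continuous_on {0..} (\<lambda>t. w t (X \<omega>, Y \<omega>'))"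
      using cont by (rule continuous_on_eq) (simp add: w)
    have "\<tau> (X \<omega>, Y \<omega>') = hitting_time (\<lambda>t. cis (- angle n \<omega>) * w t (X \<omega>, Y \<omega>')) (wedge_boundary \<alpha>)"
      unfolding \<tau>_def X_def snd_conv fst_conv
      by (intro hitting_time_eq_dyadic[symmetric] closed_wedge_boundary wedge_boundary_nonempty \<alpha> continuous_intros c'[unfolded X_def])
    also have "\<dots> = exit_time \<alpha> (angle n \<omega>) ?w"
      unfolding exit_time_eq hitting_time_def by (intro INF_cong) (auto simp: w)
    finally have \<tau>: "\<tau> (X \<omega>, Y \<omega>') = exit_time \<alpha> (angle n \<omega>) ?w" .
    have "dyadic_value (\<lambda>t. w t (X \<omega>, Y \<omega>')) (real_of_ereal (exit_time \<alpha> (angle n \<omega>) ?w))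
        = exit_point \<alpha> (angle n \<omega>) ?w"
      unfolding exit_point_def by (subst dyadic_value_eq[OF c']) (auto simp: w real_of_ereal_pos)
    then show ?thesis unfolding \<Phi>_def \<tau> by (simp add: X_def)
  qed
  have "(\<integral>\<^sup>+\<omega>. discount (time (Suc n) \<omega>) * g (R (Suc n) \<omega>) \<partial>M) = (\<integral>\<^sup>+\<omega>. \<Phi> (X \<omega>, Y \<omega>) \<partial>M)"
    by (intro nn_integral_cong) (simp add: \<Phi>_eq time_Suc R_Suc discount_add Z_eq[of n] mult.assoc)
  also have "\<dots> = (\<integral>\<^sup>+\<omega>. \<integral>\<^sup>+\<omega>'. \<Phi> (X \<omega>, Y \<omega>') \<partial>M \<partial>M)"
    by (rule nn_integral_product_law[OF law(1,2) \<Phi>_meas law(3)])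
  also have "\<dots> \<le> (\<integral>\<^sup>+\<omega>. discount (time n \<omega>) * b (R n \<omega>) \<partial>M)"
  proof (rule nn_integral_mono)
    fix \<omega> assume "\<omega> \<in> space M"
    let ?w = "\<lambda>t \<omega>'. rcis (R n \<omega>) (angle n \<omega>) + W n t \<omega>'"
    have [measurable]: "(\<lambda>\<omega>'. exit_time \<alpha> (angle n \<omega>) (\<lambda>t. ?w t \<omega>')) \<in> borel_measurable M"
      "(\<lambda>\<omega>'. exit_point \<alpha> (angle n \<omega>) (\<lambda>t. ?w t \<omega>')) \<in> borel_measurable M"
      using planar_brownian_motionD(1,3)[OF brownian_W[of n]]
      by (intro exit_time_measurable[where w = ?w] \<alpha> borel_measurable_const borel_measurable_add continuous_intros; simp)+
    have "(\<integral>\<^sup>+\<omega>'. \<Phi> (X \<omega>, Y \<omega>') \<partial>M) = (\<integral>\<^sup>+\<omega>'. discount (time n \<omega>) *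
      (discount (exit_time \<alpha> (angle n \<omega>) (\<lambda>t. ?w t \<omega>')) * g (cmod (exit_point \<alpha> (angle n \<omega>) (\<lambda>t. ?w t \<omega>')))) \<partial>M)"
      by (intro nn_integral_cong) (rule \<Phi>_eq)
    also have "\<dots> = discount (time n \<omega>) * (\<integral>\<^sup>+\<omega>'. discount (exit_time \<alpha> (angle n \<omega>) (\<lambda>t. ?w t \<omega>')) *
        g (cmod (exit_point \<alpha> (angle n \<omega>) (\<lambda>t. ?w t \<omega>'))) \<partial>M)"
      by (rule nn_integral_cmult) measurable
    also have "\<dots> \<le> discount (time n \<omega>) * b (R n \<omega>)"
      by (intro mult_left_mono le) auto
    finally show "(\<integral>\<^sup>+\<omega>'. \<Phi> (X \<omega>, Y \<omega>') \<partial>M) \<le> discount (time n \<omega>) * b (R n \<omega>)" .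
  qed
  finally show ?thesis .
qed

text \<open>The one-step estimate with both \<open>g\<close> and \<open>b\<close> the radial profile
  of \<open>resolvent\<close>. Radial symmetry matters: folding changes the angle but not the
  radius, so it leaves the value unchanged.\<close>

lemma resolvent_supermartingale:
  "(\<integral>\<^sup>+\<omega>. discount (time n \<omega>) * resolvent (of_real (R n \<omega>)) \<partial>M) \<le> resolvent (of_real r0)"
proof (induction n)
  case 0
  have "time 0 \<omega> = 0" "R 0 \<omega> = r0" for \<omega> by (auto simp: time_def elapsed_def R_def)
  then show ?case by (simp add: emeasure_space_1)
next
  case (Suc n)
  have "(\<integral>\<^sup>+\<omega>. discount (time (Suc n) \<omega>) * resolvent (of_real (R (Suc n) \<omega>)) \<partial>M)
      \<le> (\<integral>\<^sup>+\<omega>. discount (time n \<omega>) * resolvent (of_real (R n \<omega>)) \<partial>M)"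
  proof (rule nn_integral_step_le)
    fix r \<theta> :: real assume "0 \<le> r"
    then have "resolvent (rcis r \<theta>) = resolvent (of_real r)" by (subst resolvent_norm) simp
    with exit_optional_stopping[OF brownian_W[of n] \<alpha> excessive_resolvent, of \<theta> "rcis r \<theta>"]
    show "(\<integral>\<^sup>+\<omega>. discount (exit_time \<alpha> \<theta> (\<lambda>t. rcis r \<theta> + W n t \<omega>)) *
        resolvent (of_real (cmod (exit_point \<alpha> \<theta> (\<lambda>t. rcis r \<theta> + W n t \<omega>)))) \<partial>M) \<le> resolvent (of_real r)"
      by (simp flip: resolvent_norm)
  qed measurable
  with Suc show ?case by (rule order_trans[rotated])
qed

section \<open>Loss of discount and almost sure growth of the elapsed time\<close>

lemma exit_discount_measurable [measurable]: "exit_discount \<alpha> \<in> borel_measurable borel"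
  unfolding exit_discount_def[abs_def] by measurable

text \<open>Each step lowers the expected discount by at least the corresponding summand, and the
  initial discount is 1. The telescoping is kept additive to avoid subtraction in
  \<open>ennreal\<close>.\<close>

lemma discount_loss_sum:
  "(\<Sum>k<n. \<integral>\<^sup>+\<omega>. discount (time k \<omega>) * ennreal (1 - exit_discount \<alpha> (R k \<omega>)) \<partial>M)
    + (\<integral>\<^sup>+\<omega>. discount (time n \<omega>) \<partial>M) \<le> 1"
proof (induction n)
  case 0
  have "time 0 \<omega> = 0" for \<omega> by (auto simp: time_def elapsed_def)
  then show ?case by (simp add: emeasure_space_1)
next
  case (Suc n)
  let ?L = "\<integral>\<^sup>+\<omega>. discount (time n \<omega>) * ennreal (1 - exit_discount \<alpha> (R n \<omega>)) \<partial>M"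
  \<comment> \<open>The factor 1 is the constant function \<open>g\<close> in
    \<open>nn_integral_step_le\<close>.\<close>
  have "(\<integral>\<^sup>+\<omega>. discount (time (Suc n) \<omega>) * 1 \<partial>M) \<le> (\<integral>\<^sup>+\<omega>. discount (time n \<omega>) * ennreal (exit_discount \<alpha> (R n \<omega>)) \<partial>M)"
    by (rule nn_integral_step_le) (use exit_discount_bound[OF brownian_W \<alpha>] in auto)
  then have "?L + (\<integral>\<^sup>+\<omega>. discount (time (Suc n) \<omega>) \<partial>M)
      \<le> ?L + (\<integral>\<^sup>+\<omega>. discount (time n \<omega>) * ennreal (exit_discount \<alpha> (R n \<omega>)) \<partial>M)"
    by (intro add_left_mono) simp
  also have "\<dots> = (\<integral>\<^sup>+\<omega>. discount (time n \<omega>) * ennreal (1 - exit_discount \<alpha> (R n \<omega>))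
      + discount (time n \<omega>) * ennreal (exit_discount \<alpha> (R n \<omega>)) \<partial>M)"
    by (rule nn_integral_add[symmetric]) measurable
  also have "\<dots> = (\<integral>\<^sup>+\<omega>. discount (time n \<omega>) \<partial>M)"
    by (intro nn_integral_cong) (simp add: distrib_left[symmetric] flip: ennreal_plus)
  finally have "?L + (\<integral>\<^sup>+\<omega>. discount (time (Suc n) \<omega>) \<partial>M) \<le> (\<integral>\<^sup>+\<omega>. discount (time n \<omega>) \<partial>M)" .
  then have "(\<Sum>k<n. \<integral>\<^sup>+\<omega>. discount (time k \<omega>) * ennreal (1 - exit_discount \<alpha> (R k \<omega>)) \<partial>M)
      + (?L + (\<integral>\<^sup>+\<omega>. discount (time (Suc n) \<omega>) \<partial>M)) \<le> 1"
    by (rule order_trans[OF add_left_mono Suc])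
  then show ?case by (simp add: add.assoc)
qed

lemma AE_discount_loss_finite:
  "AE \<omega> in M. (\<Sum>n. discount (time n \<omega>) * ennreal (1 - exit_discount \<alpha> (R n \<omega>))) \<noteq> \<infinity>"
proof (rule nn_integral_noteq_infinite)
  have "(\<integral>\<^sup>+\<omega>. (\<Sum>n. discount (time n \<omega>) * ennreal (1 - exit_discount \<alpha> (R n \<omega>))) \<partial>M)
      = (\<Sum>n. \<integral>\<^sup>+\<omega>. discount (time n \<omega>) * ennreal (1 - exit_discount \<alpha> (R n \<omega>)) \<partial>M)"
    by (rule nn_integral_suminf) measurable
  also have "\<dots> \<le> 1"
  proof (intro suminf_le_const summableI)
    fix n
    show "(\<Sum>k<n. \<integral>\<^sup>+\<omega>. discount (time k \<omega>) * ennreal (1 - exit_discount \<alpha> (R k \<omega>)) \<partial>M) \<le> 1"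
      using discount_loss_sum[of n] by (rule order_trans[rotated]) simp
  qed
  finally show "(\<integral>\<^sup>+\<omega>. (\<Sum>n. discount (time n \<omega>) * ennreal (1 - exit_discount \<alpha> (R n \<omega>))) \<partial>M) \<noteq> \<infinity>"
    by (auto simp: top_unique)
qed measurable

text \<open>Fatou's lemma with \<open>resolvent_supermartingale\<close>; the bound is finite because
  the start is off the apex.\<close>

lemma AE_resolvent_liminf_finite:
  "AE \<omega> in M. liminf (\<lambda>n. discount (time n \<omega>) * resolvent (of_real (R n \<omega>))) \<noteq> \<infinity>"
proof (rule nn_integral_noteq_infinite)
  have "(\<integral>\<^sup>+\<omega>. liminf (\<lambda>n. discount (time n \<omega>) * resolvent (of_real (R n \<omega>))) \<partial>M)
     \<le> liminf (\<lambda>n. \<integral>\<^sup>+\<omega>. discount (time n \<omega>) * resolvent (of_real (R n \<omega>)) \<partial>M)"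
    by (rule nn_integral_liminf) measurable
  also have "\<dots> \<le> liminf (\<lambda>n. resolvent (of_real r0))"
    by (intro Liminf_mono always_eventually allI resolvent_supermartingale)
  also have "\<dots> < \<infinity>" using resolvent_finite[of "of_real r0"] r0 by (simp add: Liminf_const)
  finally show "(\<integral>\<^sup>+\<omega>. liminf (\<lambda>n. discount (time n \<omega>) * resolvent (of_real (R n \<omega>))) \<partial>M) \<noteq> \<infinity>" by simp
qed measurable

lemma AE_time_unbounded: "AE \<omega> in M. \<exists>n. ereal T < time n \<omega>"
  using AE_discount_loss_finite AE_resolvent_liminf_finite
proof eventually_elim
  case (elim \<omega>)
  show ?case
  proof (rule ccontr)
    assume "\<not> ?case"
    \<comment> \<open>Bounded elapsed time keeps all discounts above a positive constant, so the
      series of losses converges even without the discount factors.\<close>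
    then have d: "ennreal (exp (- T)) \<le> discount (time n \<omega>)" for n
      using discount_antimono[of "time n \<omega>" "ereal T"] by (simp add: not_less)
    let ?q = "\<lambda>n. exit_discount \<alpha> (R n \<omega>)"
    have "(\<Sum>n. ennreal (exp (- T)) * ennreal (1 - ?q n)) \<le> (\<Sum>n. discount (time n \<omega>) * ennreal (1 - ?q n))"
      by (intro suminf_le mult_right_mono d) auto
    with elim(1) have "(\<Sum>n. ennreal (exp (- T) * (1 - ?q n))) \<noteq> \<infinity>"
      by (auto simp: top_unique ennreal_mult)
    then have "summable (\<lambda>n. exp (- T) * (1 - ?q n))"
      by (intro summable_suminf_not_top) auto
    then have "summable (\<lambda>n. 1 - ?q n)" by (subst (asm) summable_cmult_iff) auto
    from summable_LIMSEQ_zero[OF this] have "(\<lambda>n. 1 - (1 - ?q n)) \<longlonglongrightarrow> 1 - 0"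
      by (intro tendsto_intros)
    then have q: "?q \<longlonglongrightarrow> 1" by simp
    define s where "s = sin (Theta \<alpha> / 2)"
    have s: "0 < s" unfolding s_def by (rule sin_half_Theta_pos[OF \<alpha>])
    \<comment> \<open>\<open>exit_discount\<close> is inverted: the radius is a continuous function
      of its value that vanishes at 1.\<close>
    have "R n \<omega> = sqrt (2 * (1 / ?q n - 1)) / s" for n
      using s by (simp add: exit_discount_def s_def[symmetric] real_sqrt_mult)
    moreover have "(\<lambda>n. sqrt (2 * (1 / ?q n - 1)) / s) \<longlonglongrightarrow> sqrt (2 * (1 / 1 - 1)) / s"
      using s by (intro tendsto_intros q) auto
    ultimately have "(\<lambda>n. R n \<omega>) \<longlonglongrightarrow> 0" by simp
    then have "(\<lambda>n. complex_of_real (R n \<omega>)) \<longlonglongrightarrow> 0" by (metis of_real_0 tendsto_of_real_iff)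
    \<comment> \<open>Since \<open>resolvent 0\<close> is infinite, semicontinuity forces an
      infinite limit inferior, against \<open>elim(2)\<close>.\<close>
    then have "resolvent 0 \<le> liminf (\<lambda>n. resolvent (of_real (R n \<omega>)))"
      using lower_semicontinuous_resolvent unfolding lower_semicontinuous_def by blast
    then have "ennreal (exp (- T)) * resolvent 0 \<le> liminf (\<lambda>n. ennreal (exp (- T)) * resolvent (of_real (R n \<omega>)))"
      by (intro mult_liminf_le_ennreal) auto
    also have "\<dots> \<le> liminf (\<lambda>n. discount (time n \<omega>) * resolvent (of_real (R n \<omega>)))"
      by (intro Liminf_mono always_eventually allI mult_right_mono d) auto
    finally show False
      using elim(2) by (simp add: resolvent_zero ennreal_mult_top top_unique)
  qed
qed

end

text \<open>The apex is excluded as a start: it lies on the boundary of every wedge of the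
  recursion, so from there all durations are 0 and their sum never exceeds \<open>T\<close>.\<close>

theorem proposition6:
  fixes M :: "'a measure" and Z :: "nat \<Rightarrow> real \<Rightarrow> 'a \<Rightarrow> complex"
    and \<alpha> T r0 \<theta>0 :: real and x0 :: complex
  assumes "prob_space M"
    and "0 < \<alpha>" and "\<alpha> < 2 * pi"
    and "0 < T"
    and "x0 = rcis r0 \<theta>0" and "0 \<le> r0" and "\<theta>0 \<in> {0..\<alpha>}" and "x0 \<in> wedge 0 \<alpha>"
    and "x0 \<noteq> 0"
    and "drives_algorithm_II M \<alpha> r0 \<theta>0 Z"
  shows "AE \<omega> in M. num_iterations \<alpha> r0 \<theta>0 (\<lambda>n t. Z n t \<omega>) T < \<infinity>"
proof -
  have "0 < r0" using assms by (auto simp: rcis_def less_le)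
  then interpret algorithm_II M Z \<alpha> r0 \<theta>0
    using assms by (simp add: algorithm_II_def algorithm_II_axioms_def)
  show ?thesis
    using AE_time_unbounded[of T]
  proof eventually_elim
    case (elim \<omega>)
    then obtain n where "ereal T < (\<Sum>i<n. duration \<alpha> r0 \<theta>0 (\<zeta> \<omega>) i)"
      by (auto simp: time_def elapsed_def)
    then have "num_iterations \<alpha> r0 \<theta>0 (\<zeta> \<omega>) T \<le> enat n"
      unfolding num_iterations_def by (intro INF_lower) simp
    also have "\<dots> < \<infinity>" by simp
    finally show ?case .
  qed
qed

end
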